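(* Let $1\le g\le r$ and let $\Gamma=(\gamma_1,\dots,\gamma_r)$ be a tuple of symmetric noncommutative polynomials in $x_1,\dots,x_g$ with $\gamma_j=x_j$ for $1\le j\le g$. Let $\boldsymbol K$ be an operator $\Gamma$-convex set. If $Z$ is a free extreme point of $\operatorname{opco}(\Gamma(\boldsymbol K))$, then there is a $\Gamma$-extreme point $X\in\boldsymbol K$ such that $Z=\Gamma(X)$. Thus $\mathrm{ext}(\operatorname{opco}(\Gamma(\boldsymbol K)))\subseteq\Gamma(\Gamma\text{-}\mathrm{ext}(\boldsymbol K))$. In particular, if $X\in\mathbb S^g$ and $\Gamma(X)$ is a free extreme point of $\operatorname{opco}(\Gamma(\boldsymbol K))$, then $X$ is a $\Gamma$-extreme point of $\boldsymbol K$.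
   Context: Polynomials. $\mathbb C\langle x\rangle$ is the free algebra in noncommuting variables $x_1,\dots,x_g$ with the conjugate-linear involution satisfying $x_j^*=x_j$, $(uw)^*=w^*u^*$; $q$ is symmetric if $q^*=q$. For a tuple $X$ of self-adjoint operators $\Gamma(X)=(\gamma_1(X),\dots,\gamma_r(X))$. Operator graded sets. $\mathcal H_n=\mathbb C^n$ for $n\in\mathbb N$ and $\mathcal H_\infty$ is a fixed separable infinite-dimensional Hilbert space; $\mathbb S^g_n$ is the set of $g$-tuples of bounded self-adjoint operators on $\mathcal H_n$, $n\in\mathbb N\cup\{\infty\}$, and $\mathbb S^g=(\mathbb S^g_n)_{n\in\mathbb N\cup\{\infty\}}$. A graded set is $\boldsymbol K=(K_n)_{n\in\mathbb N\cup\{\infty\}}$ with $K_n\subseteq\mathbb S^g_n$. It is free if it is closed under unitary similarity and under at most countable direct sums of norm-bounded families. $M_{m,n}$ denotes the bounded operators $\mathcal H_n\to\mathcal H_m$. A free set is operator convex if it is closed under operator convex combinations $\sum_{i=1}^kV_i^*A^{(i)}V_i$ ($k$ finite, $A^{(i)}$ in the set at level $n_i$, $V_i\in M_{n_i,n}$, $\sum_iV_i^*V_i=I_n$). $\operatorname{opco}(\boldsymbol S)$ is the intersection of all operator convex sets containing $\boldsymbol S$. A pair $(X,V)$ with $X\in\mathbb S^g_n$ and $V:\mathcal H_m\to\mathcal H_n$ an isometry is a $\Gamma$-pair if $V^*\Gamma(X)V=\Gamma(V^*XV)$. $\boldsymbol K$ is operator $\Gamma$-convex if it is free and $V^*XV\in\boldsymbol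 K$ whenever $X\in\boldsymbol K$ and $(X,V)$ is a $\Gamma$-pair. Free extreme points. Let $\boldsymbol J$ be operator convex. $X\in J_n$ is a free extreme point of $\boldsymbol J$ (written $X\in\mathrm{ext}(\boldsymbol J)$) if, whenever $X=\sum_{i=1}^kV_i^*X^{(i)}V_i$ with $k$ finite, $X^{(i)}\in J_{n_i}$, all $V_i\in M_{n_i,n}$ nonzero and $\sum_iV_i^*V_i=I_n$, for each $i$ the operator $V_i$ is a scalar multiple of an isometry $W_i$ with $W_i^*X^{(i)}W_i=X$ and, with respect to the range of $V_i$, $X^{(i)}=Y^{(i)}\oplus Z^{(i)}$ with $Y^{(i)},Z^{(i)}\in\boldsymbol J$ ($Z^{(i)}$ absent when $V_i$ is onto) and $Y^{(i)}$ unitarily equivalent to $X$. $\Gamma$-extreme points. Let $\boldsymbol K$ be operator $\Gamma$-convex. $X\in K_n$ is a $\Gamma$-extreme point of $\boldsymbol K$ (written $X\in\Gamma\text{-}\mathrm{ext}(\boldsymbol K)$) if, whenever $X=\sum_{i=1}^kV_i^*X^{(i)}V_i$ with $k$ finite, $X^{(i)}\in K_{n_i}$, all $V_i\in M_{n_i,n}$ nonzero, $\sum_iV_i^*V_i=I_n$, and $(\bigoplus_iX^{(i)},\operatorname{col}(V_1,\dots,V_k))$ a $\Gamma$-pair, then for each $i$ the operator $V_i$ is a scalar multiple of an isometry $W_i\in M_{n_i,n}$ such that $(X^{(i)},W_i)$ is a $\Gamma$-pair and, with respect to the range of $V_i$, $X^{(i)}=Y^{(i)}\oplus Z^{(i)}$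 with $Y^{(i)},Z^{(i)}\in\boldsymbol K$ ($Z^{(i)}$ absent when $V_i$ is onto) and $Y^{(i)}$ unitarily equivalent to $X$. *)

theory Defs
  imports "HOL-Analysis.Analysis" "HOL-Library.Poly_Mapping" "HOL-Library.Extended_Nat"
begin

section \<open>The complex Hilbert space of square-summable families\<close>

typedef 'a ell2 = "{x :: 'a \<Rightarrow> complex. (\<lambda>i. (cmod (x i))\<^sup>2) summable_on UNIV}"
  morphisms coord Abs_ell2
  by (rule exI[of _ "\<lambda>_. 0"]) simp

lemma coord_summable: "(\<lambda>i. (cmod (coord x i))\<^sup>2) summable_on UNIV"
  using coord[of x] by simp

lemma ell2_eqI: "(\<And>i. coord x i = coord y i) \<Longrightarrow> x = y"
  by (simp add: coord_inject[symmetric] fun_eq_iff)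

lemma ell2_add_closed:
  assumes "(\<lambda>i. (cmod (x i))\<^sup>2) summable_on UNIV" "(\<lambda>i. (cmod (y i))\<^sup>2) summable_on UNIV"
  shows "(\<lambda>i. (cmod (x i + y i))\<^sup>2) summable_on UNIV"
proof (rule summable_on_comparison_test)
  show "(\<lambda>i. 2 * (cmod (x i))\<^sup>2 + 2 * (cmod (y i))\<^sup>2) summable_on UNIV"
    by (intro summable_on_add summable_on_cmult_right assms)
  fix i
  have "(cmod (x i + y i))\<^sup>2 \<le> (cmod (x i) + cmod (y i))\<^sup>2"
    by (intro power_mono norm_triangle_ineq) auto
  also have "\<dots> \<le> 2 * (cmod (x i))\<^sup>2 + 2 * (cmod (y i))\<^sup>2"
    using sum_squares_ge_zero[of "cmod (x i) - cmod (y i)" 0]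
    by (simp add: power2_eq_square algebra_simps)
  finally show "(cmod (x i + y i))\<^sup>2 \<le> 2 * (cmod (x i))\<^sup>2 + 2 * (cmod (y i))\<^sup>2" .
qed auto

lemma ell2_scale_closed:
  assumes "(\<lambda>i. (cmod (x i))\<^sup>2) summable_on UNIV"
  shows "(\<lambda>i. (cmod (c * x i))\<^sup>2) summable_on UNIV"
  using summable_on_cmult_right[OF assms, of "(cmod c)\<^sup>2"]
  by (simp add: norm_mult power_mult_distrib)

lemma ell2_prod_summable:
  "(\<lambda>i. coord x i * cnj (coord y i)) summable_on UNIV"
proof (rule abs_summable_summable, rule Infinite_Sum.abs_summable_on_comparison_test')
  show "(\<lambda>i. (cmod (coord x i))\<^sup>2 + (cmod (coord y i))\<^sup>2) summable_on UNIV"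
    by (intro summable_on_add coord_summable)
  fix i
  have "2 * (cmod (coord x i) * cmod (coord y i)) \<le> (cmod (coord x i))\<^sup>2 + (cmod (coord y i))\<^sup>2"
    using sum_squares_ge_zero[of "cmod (coord x i) - cmod (coord y i)" 0]
    by (simp add: power2_eq_square algebra_simps)
  moreover have "0 \<le> cmod (coord x i) * cmod (coord y i)"
    by simp
  ultimately show "cmod (coord x i * cnj (coord y i))
      \<le> (cmod (coord x i))\<^sup>2 + (cmod (coord y i))\<^sup>2"
    unfolding norm_mult complex_mod_cnj by linarith
qed

definition scaleC :: "complex \<Rightarrow> 'a ell2 \<Rightarrow> 'a ell2"  (infixr \<open>*\<^sub>C\<close> 75)
  where "c *\<^sub>C x = Abs_ell2 (\<lambda>i. c * coord x i)"

definition cinner :: "'a ell2 \<Rightarrow> 'a ell2 \<Rightarrow> complex"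
  where "cinner x y = (\<Sum>\<^sub>\<infinity>i. coord x i * cnj (coord y i))"

text \<open>
  The underlying real inner product space: its norm is the usual norm of the complex
  Hilbert space, so that the library notions \<^const>\<open>bounded_linear\<close> and \<^const>\<open>onorm\<close> apply.
\<close>

instantiation ell2 :: (type) real_inner
begin

definition zero_ell2_def: "0 = Abs_ell2 (\<lambda>_. 0)"
definition plus_ell2_def: "x + y = Abs_ell2 (\<lambda>i. coord x i + coord y i)"
definition scaleR_ell2_def: "r *\<^sub>R x = Abs_ell2 (\<lambda>i. of_real r * coord x i)"
definition uminus_ell2_def: "- x = Abs_ell2 (\<lambda>i. - coord x i)"
definition minus_ell2_def: "x - y = Abs_ell2 (\<lambda>i. coord x i - coord y i)"
definition inner_ell2_def: "x \<bullet> y = Re (cinner x y)"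
definition norm_ell2_def: "norm x = sqrt (x \<bullet> x)" for x :: "'a ell2"
definition sgn_ell2_def: "sgn x = scaleR (inverse (norm x)) x" for x :: "'a ell2"
definition dist_ell2_def: "dist x y = norm (x - y)" for x y :: "'a ell2"
definition uniformity_ell2_def:
  "uniformity = (INF e\<in>{0<..}. principal {(x, y :: 'a ell2). dist x y < e})"
definition open_ell2_def:
  "open U = (\<forall>x\<in>U. eventually (\<lambda>(x', y). x' = x \<longrightarrow> y \<in> U) uniformity)" for U :: "'a ell2 set"

lemma coord_zero: "coord 0 i = 0"
  by (simp add: zero_ell2_def Abs_ell2_inverse)

lemma coord_plus: "coord (x + y) i = coord x i + coord y i"
  by (simp add: plus_ell2_def Abs_ell2_inverse ell2_add_closed coord_summable)

lemma coord_scaleR: "coord (r *\<^sub>R x) i = of_real r * coord x i"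
  by (simp add: scaleR_ell2_def Abs_ell2_inverse ell2_scale_closed coord_summable del: norm_mult)

lemma coord_uminus: "coord (- x) i = - coord x i"
  by (simp add: uminus_ell2_def Abs_ell2_inverse coord_summable)

lemma coord_minus: "coord (x - y) i = coord x i - coord y i"
  using ell2_add_closed[of "coord x" "\<lambda>i. - coord y i"]
  by (simp add: minus_ell2_def Abs_ell2_inverse coord_summable)

lemma inner_ell2_infsum: "x \<bullet> y = (\<Sum>\<^sub>\<infinity>i. Re (coord x i * cnj (coord y i)))"
  unfolding inner_ell2_def cinner_def by (rule infsum_Re[OF ell2_prod_summable, symmetric])

lemma inner_ell2_self: "x \<bullet> x = (\<Sum>\<^sub>\<infinity>i. (cmod (coord x i))\<^sup>2)"
  unfolding inner_ell2_infsum cmod_power2 by (simp add: power2_eq_square)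

instance
proof
  fix x y z :: "'a ell2" and r s :: real
  show "x + y + z = x + (y + z)" "x + y = y + x" "0 + x = x" "- x + x = 0" "x - y = x + - y"
    "r *\<^sub>R (x + y) = r *\<^sub>R x + r *\<^sub>R y" "(r + s) *\<^sub>R x = r *\<^sub>R x + s *\<^sub>R x"
    "r *\<^sub>R s *\<^sub>R x = (r * s) *\<^sub>R x" "1 *\<^sub>R x = x"
    by (auto intro!: ell2_eqI
        simp: coord_zero coord_plus coord_scaleR coord_uminus coord_minus algebra_simps)
  have re: "(\<lambda>i. Re (coord x i * cnj (coord y i))) summable_on UNIV" for x y :: "'a ell2"
    by (rule summable_on_Re[OF ell2_prod_summable])
  show "x \<bullet> y = y \<bullet> x"
    unfolding inner_ell2_infsum by (intro infsum_cong) (simp add: algebra_simps)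
  have "(x + y) \<bullet> z = (\<Sum>\<^sub>\<infinity>i. Re (coord x i * cnj (coord z i)) + Re (coord y i * cnj (coord z i)))"
    unfolding inner_ell2_infsum by (intro infsum_cong) (simp add: coord_plus algebra_simps)
  also have "\<dots> = x \<bullet> z + y \<bullet> z"
    unfolding inner_ell2_infsum by (intro infsum_add re)
  finally show "(x + y) \<bullet> z = x \<bullet> z + y \<bullet> z" .
  have "r *\<^sub>R x \<bullet> y = (\<Sum>\<^sub>\<infinity>i. r * Re (coord x i * cnj (coord y i)))"
    unfolding inner_ell2_infsum by (intro infsum_cong) (simp add: coord_scaleR algebra_simps)
  also have "\<dots> = r * (x \<bullet> y)"
    unfolding inner_ell2_infsum by (intro infsum_cmult_right re)
  finally show "r *\<^sub>R x \<bullet> y = r * (x \<bullet> y)" .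
  show "0 \<le> x \<bullet> x"
    unfolding inner_ell2_self by (intro infsum_nonneg) simp
  show "x \<bullet> x = 0 \<longleftrightarrow> x = 0"
  proof
    assume "x \<bullet> x = 0"
    then have "(cmod (coord x i))\<^sup>2 = 0" for i
      by (intro nonneg_infsum_le_0D[where A = UNIV and f = "\<lambda>i. (cmod (coord x i))\<^sup>2"])
        (auto simp: inner_ell2_self coord_summable)
    then show "x = 0"
      by (auto intro!: ell2_eqI simp: coord_zero)
  qed (simp add: inner_ell2_self coord_zero)
qed (simp_all add: norm_ell2_def sgn_ell2_def dist_ell2_def uniformity_ell2_def open_ell2_def)

end

section \<open>Operators\<close>

text \<open>
  \<open>hil S\<close> is the Hilbert space with orthonormal basis \<open>S\<close>, realised inside the families
  indexed by the whole type.  An operator from \<open>hil S\<close> to \<open>hil T\<close> is extended by zero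
  to the orthogonal complement of \<open>hil S\<close>, so that composition of operators is function
  composition and \<open>idop S\<close>, the orthogonal projection onto \<open>hil S\<close>, is the identity
  operator of \<open>hil S\<close>.
\<close>

definition hil :: "'a set \<Rightarrow> 'a ell2 set"
  where "hil S = {x. \<forall>i. i \<notin> S \<longrightarrow> coord x i = 0}"

definition idop :: "'a set \<Rightarrow> 'a ell2 \<Rightarrow> 'a ell2"
  where "idop S x = Abs_ell2 (\<lambda>i. if i \<in> S then coord x i else 0)"

definition bop :: "'a set \<Rightarrow> 'b set \<Rightarrow> ('a ell2 \<Rightarrow> 'b ell2) set"
  where "bop S T = {A. bounded_linear A \<and> (\<forall>c x. A (c *\<^sub>C x) = c *\<^sub>C A x) \<and>
    (\<forall>x. A (idop S x) = A x) \<and> range A \<subseteq> hil T}"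

text \<open>The defining equation has exactly one solution when \<open>A\<close> is in \<open>bop S T\<close>
  (Riesz representation); it then lies in \<open>bop T S\<close>.\<close>

definition adj :: "('a ell2 \<Rightarrow> 'b ell2) \<Rightarrow> 'b ell2 \<Rightarrow> 'a ell2"
  where "adj A = (THE B. \<forall>x y. cinner (A x) y = cinner x (B y))"

definition isometry_op :: "'a set \<Rightarrow> 'b set \<Rightarrow> ('a ell2 \<Rightarrow> 'b ell2) \<Rightarrow> bool"
  where "isometry_op S T V \<longleftrightarrow> V \<in> bop S T \<and> adj V \<circ> V = idop S"

definition unitary_op :: "'a set \<Rightarrow> 'b set \<Rightarrow> ('a ell2 \<Rightarrow> 'b ell2) \<Rightarrow> bool"
  where "unitary_op S T U \<longleftrightarrow> U \<in> bop S T \<and> adj U \<circ> U = idop S \<and> U \<circ> adj U = idop T"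

definition sa_tuples :: "nat \<Rightarrow> 'a set \<Rightarrow> ('a ell2 \<Rightarrow> 'a ell2) list set"
  where "sa_tuples g S = {X. length X = g \<and> (\<forall>A\<in>set X. A \<in> bop S S \<and> adj A = A)}"

definition compress ::
    "('a ell2 \<Rightarrow> 'b ell2) \<Rightarrow> ('b ell2 \<Rightarrow> 'b ell2) list \<Rightarrow> ('a ell2 \<Rightarrow> 'a ell2) list"
  where "compress V X = map (\<lambda>A. adj V \<circ> A \<circ> V) X"

section \<open>Noncommutative polynomials\<close>

text \<open>
  A noncommutative polynomial is its finitely supported family of coefficients, indexed by
  the words in the letters \<open>0, 1, \<dots>\<close>; the letter \<open>j\<close> stands for the variable \<open>x\<^sub>j\<^sub>+\<^sub>1\<close>.
\<close>

type_synonym ncpoly = "nat list \<Rightarrow>\<^sub>0 complex"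

definition free_algebra :: "nat \<Rightarrow> ncpoly set"
  where "free_algebra g = {p. Poly_Mapping.keys p \<subseteq> lists {..<g}}"

definition nc_var :: "nat \<Rightarrow> ncpoly"
  where "nc_var j = Poly_Mapping.single [j] 1"

definition nc_star :: "ncpoly \<Rightarrow> ncpoly"
  where "nc_star p = (\<Sum>w\<in>Poly_Mapping.keys p.
    Poly_Mapping.single (rev w) (cnj (Poly_Mapping.lookup p w)))"

definition eval_word :: "'a set \<Rightarrow> ('a ell2 \<Rightarrow> 'a ell2) list \<Rightarrow> nat list \<Rightarrow> 'a ell2 \<Rightarrow> 'a ell2"
  where "eval_word S X w = foldr (\<lambda>j B. (X ! j) \<circ> B) w (idop S)"

definition eval_poly :: "'a set \<Rightarrow> ncpoly \<Rightarrow> ('a ell2 \<Rightarrow> 'a ell2) list \<Rightarrow> 'a ell2 \<Rightarrow> 'a ell2"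
  where "eval_poly S p X = (\<lambda>v. \<Sum>w\<in>Poly_Mapping.keys p.
    Poly_Mapping.lookup p w *\<^sub>C eval_word S X w v)"

definition eval_tuple ::
    "'a set \<Rightarrow> ncpoly list \<Rightarrow> ('a ell2 \<Rightarrow> 'a ell2) list \<Rightarrow> ('a ell2 \<Rightarrow> 'a ell2) list"
  where "eval_tuple S \<Gamma> X = map (\<lambda>p. eval_poly S p X) \<Gamma>"

section \<open>Levels, direct sums and free sets\<close>

text \<open>
  The levels are the nonzero elements of \<^typ>\<open>enat\<close>; \<open>hil (idx n)\<close> is the \<open>n\<close>-dimensional
  Hilbert space for finite \<open>n\<close> and the space of square-summable sequences for \<open>n = \<infinity>\<close>.
  Graded sets are empty at \<open>0\<close>, which is not a level.
\<close>

definition idx :: "enat \<Rightarrow> nat set"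
  where "idx n = {i. enat i < n}"

type_synonym op = "nat ell2 \<Rightarrow> nat ell2"
type_synonym graded = "enat \<Rightarrow> op list set"

definition graded_set :: "nat \<Rightarrow> graded \<Rightarrow> bool"
  where "graded_set g K \<longleftrightarrow> K 0 = {} \<and> (\<forall>n. K n \<subseteq> sa_tuples g (idx n))"

text \<open>The orthogonal sum of the spaces \<open>hil (idx (m i))\<close> over \<open>i \<in> I\<close> is
  \<open>hil (sum_idx I m)\<close>, with the \<open>i\<close>-th summand spanned by the basis vectors \<open>(i, j)\<close>.\<close>

definition sum_idx :: "nat set \<Rightarrow> (nat \<Rightarrow> enat) \<Rightarrow> (nat \<times> nat) set"
  where "sum_idx I m = (SIGMA i:I. idx (m i))"

definition component :: "nat \<Rightarrow> (nat \<times> nat) ell2 \<Rightarrow> nat ell2"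
  where "component i x = Abs_ell2 (\<lambda>j. coord x (i, j))"

definition dsum_op :: "nat set \<Rightarrow> (nat \<Rightarrow> op) \<Rightarrow> (nat \<times> nat) ell2 \<Rightarrow> (nat \<times> nat) ell2"
  where "dsum_op I A x =
    Abs_ell2 (\<lambda>(i, j). if i \<in> I then coord (A i (component i x)) j else 0)"

definition dsum :: "nat \<Rightarrow> nat set \<Rightarrow> (nat \<Rightarrow> op list) \<Rightarrow>
    ((nat \<times> nat) ell2 \<Rightarrow> (nat \<times> nat) ell2) list"
  where "dsum g I X = map (\<lambda>l. dsum_op I (\<lambda>i. X i ! l)) [0..<g]"

definition col :: "nat \<Rightarrow> (nat \<Rightarrow> op) \<Rightarrow> nat ell2 \<Rightarrow> (nat \<times> nat) ell2"
  where "col k V x = Abs_ell2 (\<lambda>(i, j). if i < k then coord (V i x) j else 0)"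

text \<open>A direct sum is an element of the graded set only after the orthogonal sum of the
  underlying spaces has been identified with one of the spaces \<open>hil (idx n)\<close>; closure is
  required for every such identification \<open>U\<close>.\<close>

definition free_set :: "nat \<Rightarrow> graded \<Rightarrow> bool"
  where "free_set g K \<longleftrightarrow> graded_set g K \<and>
    (\<forall>n X U. X \<in> K n \<and> unitary_op (idx n) (idx n) U \<longrightarrow> compress U X \<in> K n) \<and>
    (\<forall>I m X n U. I \<noteq> {} \<and> (\<forall>i\<in>I. X i \<in> K (m i)) \<and>
       (\<exists>C. \<forall>i\<in>I. \<forall>A\<in>set (X i). onorm A \<le> C) \<and>
       unitary_op (idx n) (sum_idx I m) U \<longrightarrow> compress U (dsum g I X) \<in> K n)"

section \<open>Operator convexity and free extreme points\<close>

definition convex_coeffs :: "nat \<Rightarrow> enat \<Rightarrow> (nat \<Rightarrow> enat) \<Rightarrow> (nat \<Rightarrow> op) \<Rightarrow> bool"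
  where "convex_coeffs k n m V \<longleftrightarrow> (\<forall>i<k. V i \<in> bop (idx n) (idx (m i))) \<and>
    (\<lambda>x. \<Sum>i<k. adj (V i) (V i x)) = idop (idx n)"

definition convex_comb :: "nat \<Rightarrow> nat \<Rightarrow> (nat \<Rightarrow> op) \<Rightarrow> (nat \<Rightarrow> op list) \<Rightarrow> op list"
  where "convex_comb g k V X = map (\<lambda>l x. \<Sum>i<k. adj (V i) ((X i ! l) (V i x))) [0..<g]"

definition operator_convex :: "nat \<Rightarrow> graded \<Rightarrow> bool"
  where "operator_convex g J \<longleftrightarrow> free_set g J \<and>
    (\<forall>n k m V X. n \<noteq> 0 \<and> (\<forall>i<k. X i \<in> J (m i)) \<and> convex_coeffs k n m V \<longrightarrow>
       convex_comb g k V X \<in> J n)"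

definition opco :: "nat \<Rightarrow> graded \<Rightarrow> graded"
  where "opco g S n = \<Inter> {J n | J. operator_convex g J \<and> (\<forall>p. S p \<subseteq> J p)}"

definition unitarily_equiv :: "enat \<Rightarrow> op list \<Rightarrow> enat \<Rightarrow> op list \<Rightarrow> bool"
  where "unitarily_equiv p Y n X \<longleftrightarrow> (\<exists>U. unitary_op (idx n) (idx p) U \<and> compress U Y = X)"

text \<open>
  \<open>splits K V m A n X\<close>: with respect to the range of the operator \<open>V\<close> into \<open>hil (idx m)\<close>,
  the tuple \<open>A\<close> on \<open>hil (idx m)\<close> is a direct sum of tuples \<open>Y\<close> and \<open>Z\<close> from \<open>K\<close> (\<open>Z\<close>
  being absent when \<open>V\<close> is onto), and \<open>Y\<close> is unitarily equivalent to \<open>X\<close>.  The isometries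
  \<open>E\<close> and \<open>F\<close> identify the spaces of \<open>Y\<close> and \<open>Z\<close> with the range of \<open>V\<close> and its
  orthogonal complement in \<open>hil (idx m)\<close>.
\<close>

definition splits :: "graded \<Rightarrow> op \<Rightarrow> enat \<Rightarrow> op list \<Rightarrow> enat \<Rightarrow> op list \<Rightarrow> bool"
  where "splits K V m A n X \<longleftrightarrow>
    (\<exists>p Y E. Y \<in> K p \<and> unitarily_equiv p Y n X \<and>
       isometry_op (idx p) (idx m) E \<and> range E = range V \<and>
       (if range V = hil (idx m)
        then A = map (\<lambda>B. E \<circ> B \<circ> adj E) Y
        else \<exists>q Z F. Z \<in> K q \<and> isometry_op (idx q) (idx m) F \<and>
          range F = {y \<in> hil (idx m). \<forall>x. cinner (V x) y = 0} \<and>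
          A = map2 (\<lambda>B C x. E (B (adj E x)) + F (C (adj F x))) Y Z))"

definition free_extreme :: "nat \<Rightarrow> graded \<Rightarrow> graded"
  where "free_extreme g J n = {X \<in> J n. \<forall>k m V A.
    (\<forall>i<k. A i \<in> J (m i) \<and> V i \<noteq> (\<lambda>_. 0)) \<and> convex_coeffs k n m V \<and>
    X = convex_comb g k V A \<longrightarrow>
    (\<forall>i<k. \<exists>c W. isometry_op (idx n) (idx (m i)) W \<and> V i = (\<lambda>x. c *\<^sub>C W x) \<and>
       compress W (A i) = X \<and> splits J (V i) (m i) (A i) n X)}"

section \<open>Gamma-convexity and Gamma-extreme points\<close>

definition gamma_pair :: "nat \<Rightarrow> ncpoly list \<Rightarrow> 'a set \<Rightarrow> 'b set \<Rightarrow>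
    ('b ell2 \<Rightarrow> 'b ell2) list \<Rightarrow> ('a ell2 \<Rightarrow> 'b ell2) \<Rightarrow> bool"
  where "gamma_pair g \<Gamma> S T X V \<longleftrightarrow> X \<in> sa_tuples g T \<and> isometry_op S T V \<and>
    compress V (eval_tuple T \<Gamma> X) = eval_tuple S \<Gamma> (compress V X)"

definition gamma_convex :: "nat \<Rightarrow> ncpoly list \<Rightarrow> graded \<Rightarrow> bool"
  where "gamma_convex g \<Gamma> K \<longleftrightarrow> free_set g K \<and>
    (\<forall>m n X V. m \<noteq> 0 \<and> X \<in> K n \<and> gamma_pair g \<Gamma> (idx m) (idx n) X V \<longrightarrow> compress V X \<in> K m)"

definition gamma_extreme :: "nat \<Rightarrow> ncpoly list \<Rightarrow> graded \<Rightarrow> graded"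
  where "gamma_extreme g \<Gamma> K n = {X \<in> K n. \<forall>k m V A.
    (\<forall>i<k. A i \<in> K (m i) \<and> V i \<noteq> (\<lambda>_. 0)) \<and> convex_coeffs k n m V \<and>
    X = convex_comb g k V A \<and>
    gamma_pair g \<Gamma> (idx n) (sum_idx {..<k} m) (dsum g {..<k} A) (col k V) \<longrightarrow>
    (\<forall>i<k. \<exists>c W. isometry_op (idx n) (idx (m i)) W \<and> V i = (\<lambda>x. c *\<^sub>C W x) \<and>
       gamma_pair g \<Gamma> (idx n) (idx (m i)) (A i) W \<and> splits K (V i) (m i) (A i) n X)}"

definition gamma_image :: "ncpoly list \<Rightarrow> graded \<Rightarrow> graded"
  where "gamma_image \<Gamma> K n = eval_tuple (idx n) \<Gamma> ` K n"

end

theory Submission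
  imports Defs
begin

text \<open>
  Write \<open>J\<close> for \<open>opco (\<Gamma>(K))\<close> and let \<open>Z\<close> be a free extreme point of \<open>J\<close>.  The members of \<open>J\<close> that
  have no direct summand unitarily equivalent to \<open>Z\<close> form an operator convex set: a summand \<open>Z\<close> of a
  convex combination turns \<open>Z\<close> itself into a convex combination of the same points, and by free
  extremality it is then a summand of each point with nonzero coefficient.  If \<open>Z\<close> were not in
  \<open>\<Gamma>(K)\<close>, this set would contain \<open>\<Gamma>(K)\<close>, because a reducing subspace of \<open>\<Gamma>(A)\<close> gives a
  \<open>\<Gamma>\<close>-pair, so it would be all of \<open>J\<close>, although \<open>Z\<close> is a summand of itself.  Minimality of the hull
  thus replaces an explicit description of it, which is awkward because the direct sums of
  compressions of \<open>\<Gamma>(A\<^sub>i)\<close> in \<open>J\<close> may have an unbounded family \<open>A\<^sub>i\<close>.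

  If \<open>Z = \<Gamma>(X)\<close>, a combination for \<open>X\<close> whose column is a \<open>\<Gamma>\<close>-pair is sent by \<open>\<Gamma>\<close> to a combination
  for \<open>Z\<close>, and the first \<open>g\<close> entries of the conclusion of free extremality give \<open>\<Gamma>\<close>-extremality.
\<close>

section \<open>The complex inner product\<close>

lemma coord_Abs_ell2:
  "(\<lambda>i. (cmod (x i))\<^sup>2) summable_on UNIV \<Longrightarrow> coord (Abs_ell2 x) i = x i"
  by (simp add: Abs_ell2_inverse)

lemma coord_scaleC [simp]: "coord (c *\<^sub>C x) i = c * coord x i"
  unfolding scaleC_def by (rule coord_Abs_ell2[OF ell2_scale_closed[OF coord_summable]])

lemma coord_sum: "coord (\<Sum>a\<in>A. f a) i = (\<Sum>a\<in>A. coord (f a) i)"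
  by (induction A rule: infinite_finite_induct) (auto simp: coord_zero coord_plus)

lemma cinner_add_left: "cinner (x + y) z = cinner x z + cinner y z"
  unfolding cinner_def coord_plus distrib_right by (intro infsum_add ell2_prod_summable)

lemma cinner_scaleC_left [simp]: "cinner (c *\<^sub>C x) y = c * cinner x y"
  unfolding cinner_def coord_scaleC mult.assoc by (intro infsum_cmult_right ell2_prod_summable)

lemma cinner_commute: "cinner y x = cnj (cinner x y)"
  unfolding cinner_def infsum_cnj[symmetric] by (simp add: mult.commute)

lemma cinner_add_right: "cinner x (y + z) = cinner x y + cinner x z"
  by (metis cinner_add_left cinner_commute complex_cnj_add)

lemma cinner_scaleC_right [simp]: "cinner x (c *\<^sub>C y) = cnj c * cinner x y"
  by (metis cinner_scaleC_left cinner_commute complex_cnj_mult)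

lemma cinner_zero_left [simp]: "cinner 0 y = 0"
  by (simp add: cinner_def coord_zero)

lemma cinner_zero_right [simp]: "cinner x 0 = 0"
  by (simp add: cinner_def coord_zero)

lemma cinner_diff_left: "cinner (x - y) z = cinner x z - cinner y z"
  using cinner_add_left[of "x - y" y z] by simp

lemma cinner_diff_right: "cinner x (y - z) = cinner x y - cinner x z"
  using cinner_add_right[of x "y - z" z] by simp

lemma cinner_sum_left: "cinner (\<Sum>a\<in>A. f a) y = (\<Sum>a\<in>A. cinner (f a) y)"
  by (induction A rule: infinite_finite_induct) (auto simp: cinner_add_left)

lemma cinner_sum_right: "cinner x (\<Sum>a\<in>A. f a) = (\<Sum>a\<in>A. cinner x (f a))"
  by (induction A rule: infinite_finite_induct) (auto simp: cinner_add_right)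

lemma cinner_self: "cinner x x = of_real ((norm x)\<^sup>2)"
proof -
  have "((\<lambda>i. (cmod (coord x i))\<^sup>2) has_sum (norm x)\<^sup>2) UNIV"
    unfolding power2_norm_eq_inner[of x] inner_ell2_self by (rule has_sum_infsum[OF coord_summable])
  then have "((\<lambda>i. complex_of_real ((cmod (coord x i))\<^sup>2)) has_sum of_real ((norm x)\<^sup>2)) UNIV"
    by (rule has_sum_of_real)
  then show ?thesis
    unfolding cinner_def complex_norm_square by (rule infsumI)
qed

lemma cinner_eqI: "(\<And>u. cinner x u = cinner y u) \<Longrightarrow> x = y"
  using cinner_self[of "x - y"] by (simp add: cinner_diff_left)

lemma norm_scaleC: "norm (c *\<^sub>C x) = cmod c * norm x"
proof -
  have "complex_of_real ((norm (c *\<^sub>C x))\<^sup>2) = of_real ((cmod c * norm x)\<^sup>2)"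
    unfolding cinner_self[symmetric] cinner_scaleC_left cinner_scaleC_right power_mult_distrib
      of_real_mult complex_norm_square by (simp add: mult.assoc)
  then show ?thesis
    by (metis abs_norm_cancel norm_mult norm_of_real of_real_eq_iff power2_eq_iff_nonneg norm_ge_zero mult_nonneg_nonneg)
qed

text \<open>The real inequality only sees the real part of \<open>cinner x y\<close>. Rotating
  \<open>x\<close> by the unimodular scalar \<open>a\<close> turns the inner product into its own
  modulus, and the norm of \<open>x\<close> is unchanged.\<close>

lemma cmod_cinner_le: "cmod (cinner x y) \<le> norm x * norm y"
proof (cases "cinner x y = 0")
  case False
  define c where "c = cinner x y"
  define a where "a = cnj c / of_real (cmod c)"
  have c: "c \<noteq> 0" using False by (simp add: c_def)
  have "a * c = of_real (cmod c)"
    using c by (simp add: a_def complex_norm_square[symmetric] mult.commute power2_eq_square)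
  then have "cmod c = a *\<^sub>C x \<bullet> y"
    unfolding inner_ell2_def cinner_scaleC_left c_def[symmetric] by simp
  also have "\<dots> \<le> norm (a *\<^sub>C x) * norm y"
    by (rule norm_cauchy_schwarz)
  also have "\<dots> = norm x * norm y"
    using c by (simp add: norm_scaleC a_def norm_divide)
  finally show ?thesis by (simp add: c_def)
qed simp

lemma scaleC_one [simp]: "1 *\<^sub>C x = x"
  by (rule ell2_eqI) simp

lemma scaleC_zero_left [simp]: "0 *\<^sub>C x = 0"
  by (rule ell2_eqI) (simp add: coord_zero)

lemma scaleC_scaleC [simp]: "c *\<^sub>C d *\<^sub>C x = (c * d) *\<^sub>C x"
  by (rule ell2_eqI) simp

lemma scaleC_add_right: "c *\<^sub>C (x + y) = c *\<^sub>C x + c *\<^sub>C y"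
  by (rule ell2_eqI) (simp add: coord_plus algebra_simps)

lemma scaleC_diff_right: "c *\<^sub>C (x - y) = c *\<^sub>C x - c *\<^sub>C y"
  by (rule ell2_eqI) (simp add: coord_minus algebra_simps)

lemma scaleC_sum_right: "c *\<^sub>C (\<Sum>a\<in>A. f a) = (\<Sum>a\<in>A. c *\<^sub>C f a)"
  by (rule ell2_eqI) (simp add: coord_sum sum_distrib_left)

lemma scaleR_scaleC: "r *\<^sub>R x = of_real r *\<^sub>C x"
  by (rule ell2_eqI) (simp add: coord_scaleR)

section \<open>Bounded operators and adjoints\<close>

lemma coord_idop [simp]: "coord (idop S x) i = (if i \<in> S then coord x i else 0)"
proof -
  have "(\<lambda>i. (cmod (if i \<in> S then coord x i else 0))\<^sup>2) summable_on UNIV"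
    by (rule summable_on_comparison_test[OF coord_summable[of x]]) auto
  then show ?thesis
    unfolding idop_def by (rule coord_Abs_ell2)
qed

lemma cinner_idop: "cinner (idop S x) y = cinner x (idop S y)"
  unfolding cinner_def by (rule infsum_cong) simp

lemma idop_idop [simp]: "idop S (idop S x) = idop S x"
  by (rule ell2_eqI) simp

lemma idop_UNIV [simp]: "idop UNIV = (\<lambda>x. x)"
  by (rule ext, rule ell2_eqI) simp

lemma hil_iff_idop: "x \<in> hil S \<longleftrightarrow> idop S x = x"
  unfolding hil_def by (auto simp: fun_eq_iff coord_inject[symmetric])

lemma idop_eq_zeroD:
  assumes "idop S = (\<lambda>_. 0)"
  shows "S = {}"
proof (rule ccontr)
  assume "S \<noteq> {}"
  then obtain i where i: "i \<in> S" by auto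
  have "(\<lambda>j. (cmod (if j = i then 1 else 0))\<^sup>2) summable_on UNIV"
    by (rule finite_nonzero_values_imp_summable_on) simp
  then have "coord (Abs_ell2 (\<lambda>j. if j = i then 1 else 0)) i = 1"
    by (simp add: coord_Abs_ell2)
  moreover have "coord (idop S (Abs_ell2 (\<lambda>j. if j = i then 1 else 0))) i = 0"
    using assms by (simp add: coord_zero)
  ultimately show False using i by simp
qed

text \<open>Over \<open>UNIV\<close> both support conditions of \<open>bop\<close> are void, so
  boundedness and complex linearity remain. The algebraic laws can then be used without tracking
  levels.\<close>

definition clinear_op :: "('a ell2 \<Rightarrow> 'b ell2) \<Rightarrow> bool"
  where "clinear_op A \<longleftrightarrow> A \<in> bop UNIV UNIV"

lemma clinear_op_iff:
  "clinear_op A \<longleftrightarrow> bounded_linear A \<and> (\<forall>c x. A (c *\<^sub>C x) = c *\<^sub>C A x)"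
  unfolding clinear_op_def bop_def hil_def by auto

lemma clinear_opI:
  assumes "\<And>x y. A (x + y) = A x + A y" "\<And>c x. A (c *\<^sub>C x) = c *\<^sub>C A x"
    and "\<And>x. norm (A x) \<le> C * norm x"
  shows "clinear_op A"
  unfolding clinear_op_iff
  by (auto intro!: bounded_linear_intro[where K = C] assms simp: scaleR_scaleC mult.commute[of _ C])

text \<open>Expressing the range condition as a fixed-point equation of a projection makes both
  support conditions usable as rewrite rules.\<close>

lemma bop_iff:
  "A \<in> bop S T \<longleftrightarrow> clinear_op A \<and> (\<forall>x. A (idop S x) = A x) \<and> (\<forall>x. idop T (A x) = A x)"
  unfolding clinear_op_iff bop_def by (auto simp: hil_iff_idop image_subset_iff)

lemma bop_clinear: "A \<in> bop S T \<Longrightarrow> clinear_op A"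
  by (simp add: bop_iff)

lemma bop_idop_right: "A \<in> bop S T \<Longrightarrow> A (idop S x) = A x"
  by (simp add: bop_iff)

lemma bop_idop_left: "A \<in> bop S T \<Longrightarrow> idop T (A x) = A x"
  by (simp add: bop_iff)

lemma clinear_op_add: "clinear_op A \<Longrightarrow> A (x + y) = A x + A y"
  by (simp add: clinear_op_iff bounded_linear_def linear_add)

lemma clinear_op_diff: "clinear_op A \<Longrightarrow> A (x - y) = A x - A y"
  by (simp add: clinear_op_iff bounded_linear_def linear_diff)

lemma clinear_op_zero: "clinear_op A \<Longrightarrow> A 0 = 0"
  by (simp add: clinear_op_iff bounded_linear_def linear_0)

lemma clinear_op_scaleC: "clinear_op A \<Longrightarrow> A (c *\<^sub>C x) = c *\<^sub>C A x"
  by (simp add: clinear_op_iff)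

lemma clinear_op_sum: "clinear_op A \<Longrightarrow> A (\<Sum>i\<in>I. f i) = (\<Sum>i\<in>I. A (f i))"
  by (simp add: clinear_op_iff bounded_linear_def linear_sum)

lemma clinear_op_compose: "clinear_op A \<Longrightarrow> clinear_op B \<Longrightarrow> clinear_op (\<lambda>x. A (B x))"
  unfolding clinear_op_iff by (auto intro: bounded_linear_compose)

lemma clinear_op_sumI: "(\<And>i. i \<in> I \<Longrightarrow> clinear_op (A i)) \<Longrightarrow> clinear_op (\<lambda>x. \<Sum>i\<in>I. A i x)"
  unfolding clinear_op_iff
  by (auto intro!: bounded_linear_sum sum.cong simp: scaleC_sum_right)

lemma clinear_op_diffI: "clinear_op A \<Longrightarrow> clinear_op B \<Longrightarrow> clinear_op (\<lambda>x. A x - B x)"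
  unfolding clinear_op_iff by (auto intro: bounded_linear_sub simp: scaleC_diff_right)

text \<open>Moving the map across the inner product transfers linearity from the first argument of
  \<open>cinner\<close>, because inner products separate vectors. Projections, adjoints, embeddings
  and direct sums then only need a norm bound.\<close>

lemma clinear_op_formal_adjointI:
  assumes adj: "\<And>x y. cinner (A x) y = cinner x (B y)" and "\<And>x. norm (A x) \<le> C * norm x"
  shows "clinear_op A"
proof (rule clinear_opI)
  show "A (x + y) = A x + A y" for x y
    by (rule cinner_eqI) (simp add: adj cinner_add_left)
  show "A (c *\<^sub>C x) = c *\<^sub>C A x" for c x
    by (rule cinner_eqI) (simp add: adj)
qed (rule assms)

text \<open>Cauchy-Schwarz bounds the square of \<open>norm x\<close> by
  \<open>norm y * norm x\<close>, and one factor cancels. Orthogonal projections are contractions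
  for this reason.\<close>

lemma norm_le_of_cinner:
  assumes "cinner x x = cinner y z" "norm z \<le> norm x"
  shows "norm x \<le> norm y"
proof -
  have "(norm x)\<^sup>2 = cmod (cinner y z)"
    unfolding assms(1)[symmetric] cinner_self norm_of_real by simp
  also have "\<dots> \<le> norm y * norm x"
    using cmod_cinner_le[of y z] assms(2) by (meson mult_left_mono norm_ge_zero order_trans)
  finally show ?thesis
    by (cases "norm x = 0") (auto simp: power2_eq_square)
qed

lemma norm_idop_le: "norm (idop S x) \<le> norm x"
  by (rule norm_le_of_cinner[of _ _ "idop S x"]) (simp_all add: cinner_idop)

lemma idop_clinear: "clinear_op (idop S)"
  by (rule clinear_op_formal_adjointI[where C = 1, OF cinner_idop]) (simp add: norm_idop_le)

lemma idop_bop: "idop S \<in> bop S S"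
  by (simp add: bop_iff idop_clinear)

section \<open>Finite truncations and the existence of adjoints\<close>

lemma norm_idop_finite:
  assumes "finite F"
  shows "(norm (idop F x))\<^sup>2 = (\<Sum>i\<in>F. (cmod (coord x i))\<^sup>2)"
proof -
  have "(norm (idop F x))\<^sup>2 = (\<Sum>\<^sub>\<infinity>i. (cmod (coord (idop F x) i))\<^sup>2)"
    by (simp add: power2_norm_eq_inner inner_ell2_self)
  also have "\<dots> = (\<Sum>\<^sub>\<infinity>i\<in>F. (cmod (coord x i))\<^sup>2)"
    by (rule infsum_cong_neutral) auto
  finally show ?thesis using assms by simp
qed

text \<open>By Pythagoras the squared norm of the tail is the difference of two squared norms, which
  vanishes in the limit because the squared coordinates sum to the squared norm.\<close>

lemma idop_finite_tendsto: "((\<lambda>F. idop F x) \<longlongrightarrow> x) (finite_subsets_at_top UNIV)"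
proof -
  have sq: "(norm (x - idop F x))\<^sup>2 = (norm x)\<^sup>2 - (norm (idop F x))\<^sup>2" for F
  proof -
    have "complex_of_real ((norm (x - idop F x))\<^sup>2)
        = of_real ((norm x)\<^sup>2) - of_real ((norm (idop F x))\<^sup>2)"
      unfolding cinner_self[symmetric] by (simp add: cinner_diff_left cinner_diff_right cinner_idop)
    then show ?thesis
      by (metis of_real_diff of_real_eq_iff)
  qed
  have "((\<lambda>i. (cmod (coord x i))\<^sup>2) has_sum (norm x)\<^sup>2) UNIV"
    using has_sum_infsum[OF coord_summable[of x]] by (simp add: power2_norm_eq_inner inner_ell2_self)
  then have "((\<lambda>F. \<Sum>i\<in>F. (cmod (coord x i))\<^sup>2) \<longlongrightarrow> (norm x)\<^sup>2) (finite_subsets_at_top UNIV)"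
    by (simp add: has_sum_def)
  then have "((\<lambda>F. (norm (idop F x))\<^sup>2) \<longlongrightarrow> (norm x)\<^sup>2) (finite_subsets_at_top UNIV)"
    by (rule Lim_transform_eventually)
      (auto intro!: eventually_finite_subsets_at_top_weakI simp: norm_idop_finite)
  then have "((\<lambda>F. sqrt ((norm x)\<^sup>2 - (norm (idop F x))\<^sup>2)) \<longlongrightarrow> sqrt ((norm x)\<^sup>2 - (norm x)\<^sup>2))
      (finite_subsets_at_top UNIV)"
    by (intro tendsto_real_sqrt tendsto_diff tendsto_const)
  then have "((\<lambda>F. norm (x - idop F x)) \<longlongrightarrow> 0) (finite_subsets_at_top UNIV)"
    unfolding sq[symmetric] by simp
  then show ?thesis
    by (subst tendsto_dist_iff) (simp add: dist_norm norm_minus_commute)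
qed

definition ebasis :: "'a \<Rightarrow> 'a ell2"
  where "ebasis i = Abs_ell2 (\<lambda>j. if j = i then 1 else 0)"

lemma coord_ebasis [simp]: "coord (ebasis i) j = (if j = i then 1 else 0)"
  unfolding ebasis_def
  by (rule coord_Abs_ell2, rule finite_nonzero_values_imp_summable_on) simp

lemma idop_finite_eq_sum:
  "finite F \<Longrightarrow> idop F x = (\<Sum>i\<in>F. coord x i *\<^sub>C ebasis i)"
  by (rule ell2_eqI) (auto simp: coord_sum if_distrib cong: if_cong)

text \<open>The coordinates of \<open>B y\<close> are forced: they are the conjugates of
  \<open>cinner (A (ebasis i)) y\<close>. Boundedness of \<open>A\<close> makes them square
  summable, and the adjoint relation holds on finite truncations by linearity and passes to the
  limit by continuity.\<close>

lemma adjoint_exists: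
  assumes A: "clinear_op A"
  shows "\<exists>B. \<forall>x y. cinner (A x) y = cinner x (B y)"
proof -
  obtain C where C: "\<And>x. norm (A x) \<le> norm x * C" and C0: "C \<ge> 0"
    using A unfolding clinear_op_iff by (meson bounded_linear.nonneg_bounded)
  define c where "c y i = cinner (A (ebasis i)) y" for y i
  have A_sum: "cinner (A (\<Sum>i\<in>F. a i *\<^sub>C ebasis i)) y = (\<Sum>i\<in>F. a i * c y i)" for F a y
    by (simp add: clinear_op_sum[OF A] clinear_op_scaleC[OF A] cinner_sum_left c_def)
  have bound: "(\<Sum>i\<in>F. (cmod (c y i))\<^sup>2) \<le> (C * norm y)\<^sup>2" if "finite F" for F y
  proof -
    \<comment> \<open>This test vector is the extremal one for duality: both its squared norm and
      \<open>cinner (A x) y\<close> equal the partial sum \<open>s\<close>, so boundedness of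
      \<open>A\<close> bounds \<open>s\<close>.\<close>
    define x where "x = (\<Sum>i\<in>F. cnj (c y i) *\<^sub>C ebasis i)"
    define s where "s = (\<Sum>i\<in>F. (cmod (c y i))\<^sup>2)"
    have "coord x i = (if i \<in> F then cnj (c y i) else 0)" for i
      using that by (auto simp: x_def coord_sum if_distrib cong: if_cong)
    then have "idop F x = x" and "(norm (idop F x))\<^sup>2 = s"
      using that by (auto intro!: ell2_eqI simp: norm_idop_finite s_def)
    then have nx: "(norm x)\<^sup>2 = s"
      by simp
    have "cinner (A x) y = of_real s"
      unfolding x_def A_sum s_def of_real_sum complex_norm_square by (simp add: mult.commute)
    moreover have "0 \<le> s"
      by (simp add: s_def sum_nonneg)
    ultimately have "s = cmod (cinner (A x) y)"
      by (metis abs_of_nonneg norm_of_real)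
    also have "\<dots> \<le> norm x * C * norm y"
      using cmod_cinner_le[of "A x" y] C[of x] by (meson mult_right_mono norm_ge_zero order_trans)
    finally have "norm x * norm x \<le> norm x * (C * norm y)"
      using nx by (simp add: power2_eq_square mult.assoc)
    then have "norm x \<le> C * norm y"
      using C0 by (cases "norm x = 0") auto
    then have "(norm x)\<^sup>2 \<le> (C * norm y)\<^sup>2"
      by (rule power_mono) simp
    then show ?thesis
      by (simp add: nx s_def)
  qed
  have summ: "(\<lambda>i. (cmod (cnj (c y i)))\<^sup>2) summable_on UNIV" for y
    using bound by (intro nonneg_bdd_above_summable_on) (auto simp: bdd_above_def)
  define B where "B y = Abs_ell2 (\<lambda>i. cnj (c y i))" for y
  have cB: "coord (B y) i = cnj (c y i)" for y i
    unfolding B_def by (rule coord_Abs_ell2[OF summ])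
  have "cinner (A x) y = cinner x (B y)" for x y
  proof (rule tendsto_unique)
    have "((\<lambda>F. A (idop F x)) \<longlongrightarrow> A x) (finite_subsets_at_top UNIV)"
      using A unfolding clinear_op_iff by (auto intro: bounded_linear.tendsto idop_finite_tendsto)
    moreover have "bounded_linear (\<lambda>z. cinner z y)"
      by (rule bounded_linear_intro[where K = "norm y"])
        (simp_all add: cinner_add_left scaleR_scaleC cmod_cinner_le scaleR_conv_of_real)
    ultimately show "((\<lambda>F. cinner (A (idop F x)) y) \<longlongrightarrow> cinner (A x) y) (finite_subsets_at_top UNIV)"
      by (rule bounded_linear.tendsto[rotated])
    have "((\<lambda>i. coord x i * cnj (coord (B y) i)) has_sum cinner x (B y)) UNIV"
      unfolding cinner_def by (rule has_sum_infsum[OF ell2_prod_summable])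
    then have "((\<lambda>F. \<Sum>i\<in>F. coord x i * c y i) \<longlongrightarrow> cinner x (B y)) (finite_subsets_at_top UNIV)"
      by (simp add: has_sum_def cB)
    then show "((\<lambda>F. cinner (A (idop F x)) y) \<longlongrightarrow> cinner x (B y)) (finite_subsets_at_top UNIV)"
      by (rule Lim_transform_eventually)
        (auto intro!: eventually_finite_subsets_at_top_weakI simp: idop_finite_eq_sum A_sum)
  qed simp
  then show ?thesis by blast
qed

text \<open>Inner products separate vectors, so the definite description has at most one candidate
  and exhibiting any formal adjoint settles it.\<close>

lemma adj_eqI:
  assumes "\<And>x y. cinner (A x) y = cinner x (B y)"
  shows "adj A = B"
  unfolding adj_def
proof (rule the_equality)
  fix B' assume B': "\<forall>x y. cinner (A x) y = cinner x (B' y)"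
  show "B' = B"
  proof
    fix y
    show "B' y = B y"
      by (rule cinner_eqI) (metis B' assms cinner_commute)
  qed
qed (use assms in blast)

lemma cinner_adj: "clinear_op A \<Longrightarrow> cinner (A x) y = cinner x (adj A y)"
  using adjoint_exists[of A] adj_eqI[of A] by metis

lemma cinner_adj': "clinear_op A \<Longrightarrow> cinner (adj A x) y = cinner x (A y)"
  by (metis cinner_adj cinner_commute)

lemma adj_clinear:
  assumes A: "clinear_op A"
  shows "clinear_op (adj A)"
proof -
  obtain C where C: "\<And>x. norm (A x) \<le> norm x * C" and C0: "C \<ge> 0"
    using A unfolding clinear_op_iff by (meson bounded_linear.nonneg_bounded)
  have "norm (adj A y) \<le> C * norm y" for y
  proof -
    have "(norm (adj A y))\<^sup>2 = cmod (cinner (A (adj A y)) y)"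
      unfolding cinner_adj[OF A] cinner_self norm_of_real by simp
    also have "\<dots> \<le> norm (adj A y) * C * norm y"
      using cmod_cinner_le[of "A (adj A y)" y] C[of "adj A y"]
      by (meson mult_right_mono norm_ge_zero order_trans)
    finally show ?thesis
      using C0 by (cases "norm (adj A y) = 0") (auto simp: power2_eq_square mult.assoc)
  qed
  then show ?thesis
    by (rule clinear_op_formal_adjointI[OF cinner_adj'[OF A]])
qed

lemma adj_compose:
  "clinear_op A \<Longrightarrow> clinear_op B \<Longrightarrow> adj (\<lambda>x. A (B x)) = (\<lambda>x. adj B (adj A x))"
  by (rule adj_eqI) (simp add: cinner_adj)

lemma adj_idop [simp]: "adj (idop S) = idop S"
  by (rule adj_eqI) (rule cinner_idop)

lemma adj_bop:
  assumes "A \<in> bop S T"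
  shows "adj A \<in> bop T S"
proof -
  note A = bop_clinear[OF assms]
  have "adj A (idop T y) = adj A y" for y
    by (rule cinner_eqI)
      (simp add: cinner_adj'[OF A] cinner_idop bop_idop_left[OF assms])
  moreover have "idop S (adj A y) = adj A y" for y
    by (rule cinner_eqI)
      (simp add: cinner_adj'[OF A] cinner_idop bop_idop_right[OF assms])
  ultimately show ?thesis
    by (simp add: bop_iff adj_clinear[OF A])
qed

lemma bop_compose: "A \<in> bop T R \<Longrightarrow> B \<in> bop S T \<Longrightarrow> (\<lambda>x. A (B x)) \<in> bop S R"
  by (auto simp: bop_iff clinear_op_compose)

lemma bop_sum:
  "(\<And>i. i \<in> I \<Longrightarrow> A i \<in> bop S T) \<Longrightarrow> (\<lambda>x. \<Sum>i\<in>I. A i x) \<in> bop S T"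
  by (auto simp: bop_iff clinear_op_sum[OF idop_clinear] intro!: clinear_op_sumI)

lemma bop_scaleC: "A \<in> bop S T \<Longrightarrow> (\<lambda>x. c *\<^sub>C A x) \<in> bop S T"
proof -
  assume A: "A \<in> bop S T"
  have "clinear_op (\<lambda>x :: 'b ell2. c *\<^sub>C x)"
    by (rule clinear_opI[where C = "cmod c"])
      (simp_all add: scaleC_add_right norm_scaleC mult.commute)
  from clinear_op_compose[OF this bop_clinear[OF A]] A show ?thesis
    by (simp add: bop_iff clinear_op_scaleC[OF idop_clinear])
qed

section \<open>Isometries and tuples\<close>

lemma isometry_op_bop: "isometry_op S T V \<Longrightarrow> V \<in> bop S T"
  by (simp add: isometry_op_def)

lemma isometry_op_adj: "isometry_op S T V \<Longrightarrow> adj V (V x) = idop S x"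
  by (simp add: isometry_op_def fun_eq_iff)

lemma isometry_opI: "V \<in> bop S T \<Longrightarrow> (\<And>x. adj V (V x) = idop S x) \<Longrightarrow> isometry_op S T V"
  by (simp add: isometry_op_def fun_eq_iff)

lemma unitary_op_isometry: "unitary_op S T U \<Longrightarrow> isometry_op S T U"
  by (simp add: unitary_op_def isometry_op_def)

lemma unitary_op_right: "unitary_op S T U \<Longrightarrow> U (adj U x) = idop T x"
  by (simp add: unitary_op_def fun_eq_iff)

lemma isometry_op_compose:
  assumes "isometry_op S T V" "isometry_op T R U"
  shows "isometry_op S R (\<lambda>x. U (V x))"
proof (rule isometry_opI)
  note V = isometry_op_bop[OF assms(1)] and U = isometry_op_bop[OF assms(2)]
  show "(\<lambda>x. U (V x)) \<in> bop S R"
    by (rule bop_compose[OF U V])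
  show "adj (\<lambda>x. U (V x)) (U (V x)) = idop S x" for x
    unfolding adj_compose[OF bop_clinear[OF U] bop_clinear[OF V]]
    by (simp add: isometry_op_adj[OF assms(1)] isometry_op_adj[OF assms(2)] bop_idop_left[OF V])
qed

lemma isometry_op_idop: "isometry_op S S (idop S)"
  by (rule isometry_opI) (simp_all add: idop_bop)

lemma sa_tuples_iff:
  "X \<in> sa_tuples g S \<longleftrightarrow> length X = g \<and> (\<forall>l<g. X ! l \<in> bop S S \<and> adj (X ! l) = X ! l)"
  unfolding sa_tuples_def by (auto simp: set_conv_nth)

lemma sa_tuples_length: "X \<in> sa_tuples g S \<Longrightarrow> length X = g"
  by (simp add: sa_tuples_iff)

lemma sa_tuples_bop: "X \<in> sa_tuples g S \<Longrightarrow> l < g \<Longrightarrow> X ! l \<in> bop S S"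
  by (simp add: sa_tuples_iff)

lemma sa_tuples_adj: "X \<in> sa_tuples g S \<Longrightarrow> l < g \<Longrightarrow> adj (X ! l) = X ! l"
  by (simp add: sa_tuples_iff)

lemma length_compress [simp]: "length (compress V X) = length X"
  by (simp add: compress_def)

lemma compress_nth: "l < length X \<Longrightarrow> (compress V X ! l) x = adj V ((X ! l) (V x))"
  by (simp add: compress_def)

text \<open>Each summand can be moved across the inner product separately. The target space may vary
  with \<open>i\<close>, so that convex combinations across levels are covered; a single compression
  is the one-term case.\<close>

lemma sum_compress_selfadjoint:
  assumes V: "\<And>i. i \<in> I \<Longrightarrow> V i \<in> bop S (T i)"
    and A: "\<And>i. i \<in> I \<Longrightarrow> A i \<in> bop (T i) (T i) \<and> adj (A i) = A i"
  shows "(\<lambda>x. \<Sum>i\<in>I. adj (V i) (A i (V i x))) \<in> bop S S"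
    and "adj (\<lambda>x. \<Sum>i\<in>I. adj (V i) (A i (V i x))) = (\<lambda>x. \<Sum>i\<in>I. adj (V i) (A i (V i x)))"
proof -
  show "(\<lambda>x. \<Sum>i\<in>I. adj (V i) (A i (V i x))) \<in> bop S S"
    by (rule bop_sum, rule bop_compose[OF adj_bop[OF V] bop_compose[OF conjunct1[OF A] V]])
  show "adj (\<lambda>x. \<Sum>i\<in>I. adj (V i) (A i (V i x))) = (\<lambda>x. \<Sum>i\<in>I. adj (V i) (A i (V i x)))"
  proof (rule adj_eqI, unfold cinner_sum_left cinner_sum_right, rule sum.cong[OF refl])
    fix x y i assume i: "i \<in> I"
    have Vi: "clinear_op (V i)" and Ai: "clinear_op (A i)" "adj (A i) = A i"
      using V[OF i] A[OF i] by (auto intro: bop_clinear)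
    have "cinner (adj (V i) (A i (V i x))) y = cinner (A i (V i x)) (V i y)"
      by (rule cinner_adj'[OF Vi])
    also have "\<dots> = cinner (V i x) (A i (V i y))"
      using cinner_adj[OF Ai(1)] Ai(2) by simp
    also have "\<dots> = cinner x (adj (V i) (A i (V i y)))"
      by (rule cinner_adj[OF Vi])
    finally show "cinner (adj (V i) (A i (V i x))) y = cinner x (adj (V i) (A i (V i y)))" .
  qed
qed

lemma compress_sa_tuples:
  assumes "V \<in> bop S T" "X \<in> sa_tuples g T"
  shows "compress V X \<in> sa_tuples g S"
proof -
  have "compress V X ! l \<in> bop S S \<and> adj (compress V X ! l) = compress V X ! l" if "l < g" for l
  proof -
    have "compress V X ! l = (\<lambda>x. \<Sum>i\<in>{()}. adj V ((X ! l) (V x)))"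
      using that sa_tuples_length[OF assms(2)] by (auto simp: compress_nth)
    then show ?thesis
      using sum_compress_selfadjoint[of "{()}" "\<lambda>_. V" S "\<lambda>_. T" "\<lambda>_. X ! l"] assms that
      by (simp add: sa_tuples_iff)
  qed
  then show ?thesis
    by (simp add: sa_tuples_iff sa_tuples_length[OF assms(2)])
qed

section \<open>Evaluation of noncommutative polynomials\<close>

lemma eval_word_Nil [simp]: "eval_word S X [] = idop S"
  by (simp add: eval_word_def)

lemma eval_word_Cons [simp]: "eval_word S X (j # w) x = (X ! j) (eval_word S X w x)"
  by (simp add: eval_word_def)

lemma eval_word_bop:
  assumes "X \<in> sa_tuples g S" "w \<in> lists {..<g}"
  shows "eval_word S X w \<in> bop S S"
  using assms(2)
proof (induction w)
  case (Cons j w)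
  then have "(\<lambda>x. (X ! j) (eval_word S X w x)) \<in> bop S S"
    by (auto intro: bop_compose[OF sa_tuples_bop[OF assms(1)]])
  then show ?case
    by (simp add: eval_word_def o_def)
qed (simp add: idop_bop)

text \<open>The empty word evaluates to \<open>idop S\<close> and not to the identity map. The
  projection that ends the evaluation of \<open>u\<close> is absorbed because the evaluation of
  \<open>v\<close> maps into \<open>hil S\<close>.\<close>

lemma eval_word_append:
  assumes "X \<in> sa_tuples g S" "v \<in> lists {..<g}"
  shows "eval_word S X (u @ v) x = eval_word S X u (eval_word S X v x)"
  using bop_idop_left[OF eval_word_bop[OF assms]] by (induction u) auto

lemma cinner_eval_word:
  assumes X: "X \<in> sa_tuples g S" and "w \<in> lists {..<g}"
  shows "cinner (eval_word S X w x) y = cinner x (eval_word S X (rev w) y)"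
  using assms(2)
proof (induction w arbitrary: y)
  case (Cons j w)
  then have j: "j < g" and w: "w \<in> lists {..<g}" by auto
  note Xj = sa_tuples_bop[OF X j]
  have "cinner (eval_word S X (j # w) x) y = cinner x (eval_word S X (rev w) ((X ! j) y))"
    using cinner_adj[OF bop_clinear[OF Xj]] sa_tuples_adj[OF X j] Cons.IH by simp
  \<comment> \<open>Reading the single letter as a word allows it to be appended to
    \<open>rev w\<close>.\<close>
  also have "(X ! j) y = eval_word S X [j] y"
    by (simp add: bop_idop_right[OF Xj])
  finally show ?case
    using eval_word_append[OF X, of "[j]" "rev w" y] j by simp
qed (simp add: cinner_idop)

lemma free_algebra_key: "p \<in> free_algebra g \<Longrightarrow> w \<in> Poly_Mapping.keys p \<Longrightarrow> w \<in> lists {..<g}"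
  by (auto simp: free_algebra_def)

lemma eval_poly_bop:
  assumes "X \<in> sa_tuples g S" "p \<in> free_algebra g"
  shows "eval_poly S p X \<in> bop S S"
  unfolding eval_poly_def
  using assms by (intro bop_sum bop_scaleC eval_word_bop) (auto dest: free_algebra_key)

lemma lookup_nc_star: "Poly_Mapping.lookup (nc_star p) w = cnj (Poly_Mapping.lookup p (rev w))"
proof -
  have "Poly_Mapping.lookup (nc_star p) w
      = (\<Sum>v\<in>Poly_Mapping.keys p. if v = rev w then cnj (Poly_Mapping.lookup p v) else 0)"
    unfolding nc_star_def lookup_sum lookup_single
    by (intro sum.cong) (auto simp: when_def)
  also have "\<dots> = cnj (Poly_Mapping.lookup p (rev w))"
    by (simp add: in_keys_iff)
  finally show ?thesis .
qed

text \<open>The adjoint of a word is the reversed word. Symmetry of \<open>p\<close> makes reversal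
  a permutation of its support that conjugates coefficients, so reindexing the sum returns
  \<open>p\<close>.\<close>

lemma eval_poly_selfadjoint:
  assumes X: "X \<in> sa_tuples g S" and p: "p \<in> free_algebra g" "nc_star p = p"
  shows "adj (eval_poly S p X) = eval_poly S p X"
proof (rule adj_eqI)
  fix x y
  let ?K = "Poly_Mapping.keys p"
  have l: "cnj (Poly_Mapping.lookup p (rev w)) = Poly_Mapping.lookup p w" for w
    using lookup_nc_star[of p w] p(2) by simp
  then have "rev w \<in> ?K \<longleftrightarrow> w \<in> ?K" for w
    by (metis complex_cnj_zero_iff in_keys_iff)
  then have bij: "bij_betw rev ?K ?K"
    by (intro bij_betwI[where g = rev]) auto
  have "cinner (eval_poly S p X x) y
      = (\<Sum>w\<in>?K. Poly_Mapping.lookup p w * cinner x (eval_word S X (rev w) y))"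
    unfolding eval_poly_def
    by (simp add: cinner_sum_left cinner_eval_word[OF X free_algebra_key[OF p(1)]])
  also have "\<dots> = (\<Sum>w\<in>?K. Poly_Mapping.lookup p (rev w) * cinner x (eval_word S X w y))"
    by (subst sum.reindex_bij_betw[OF bij, symmetric]) simp
  also have "\<dots> = cinner x (eval_poly S p X y)"
    unfolding eval_poly_def cinner_sum_right cinner_scaleC_right
    using l by (metis complex_cnj_cnj)
  finally show "cinner (eval_poly S p X x) y = cinner x (eval_poly S p X y)" .
qed

lemma length_eval_tuple [simp]: "length (eval_tuple S \<Gamma> X) = length \<Gamma>"
  by (simp add: eval_tuple_def)

lemma eval_tuple_nth [simp]: "l < length \<Gamma> \<Longrightarrow> eval_tuple S \<Gamma> X ! l = eval_poly S (\<Gamma> ! l) X"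
  by (simp add: eval_tuple_def)

lemma eval_tuple_sa_tuples:
  assumes "X \<in> sa_tuples g S" "\<forall>p\<in>set \<Gamma>. p \<in> free_algebra g \<and> nc_star p = p"
  shows "eval_tuple S \<Gamma> X \<in> sa_tuples (length \<Gamma>) S"
  using assms by (auto simp: sa_tuples_iff intro!: eval_poly_bop eval_poly_selfadjoint)

lemma eval_poly_nc_var:
  assumes "X \<in> sa_tuples g S" "j < g"
  shows "eval_poly S (nc_var j) X = X ! j"
  by (rule ext)
    (simp add: eval_poly_def nc_var_def bop_idop_right[OF sa_tuples_bop[OF assms]])

text \<open>The first \<open>g\<close> polynomials are the variables. Hence \<Gamma> is injective on
  self-adjoint tuples, and truncation carries facts about \<Gamma>(A) back to A.\<close>

lemma take_eval_tuple:
  assumes "X \<in> sa_tuples g S" "g \<le> length \<Gamma>" "\<forall>j<g. \<Gamma> ! j = nc_var j"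
  shows "take g (eval_tuple S \<Gamma> X) = X"
  using assms sa_tuples_length[OF assms(1)]
  by (intro nth_equalityI) (auto simp: eval_poly_nc_var[OF assms(1)])

text \<open>Induction on words moves \<open>E\<close> past one letter at a time. The empty word is
  the case where \<open>E\<close> has to respect the two projections \<open>idop S\<close> and
  \<open>idop T\<close>.\<close>

lemma eval_poly_intertwine:
  assumes E: "E \<in> bop S T" and p: "p \<in> free_algebra g"
    and XY: "\<And>l x. l < g \<Longrightarrow> (X ! l) (E x) = E ((Y ! l) x)"
  shows "eval_poly T p X (E x) = E (eval_poly S p Y x)"
proof -
  note lin = clinear_op_sum[OF bop_clinear[OF E]] clinear_op_scaleC[OF bop_clinear[OF E]]
  have "eval_word T X w (E x) = E (eval_word S Y w x)" if "w \<in> lists {..<g}" for w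
    using that by (induction w) (auto simp: bop_idop_left[OF E] bop_idop_right[OF E] XY)
  then show ?thesis
    unfolding eval_poly_def using free_algebra_key[OF p] by (auto simp: lin intro!: sum.cong)
qed

lemma compress_intertwine:
  assumes E: "isometry_op S T E" and Y: "Y \<in> sa_tuples g S" and X: "length X = g"
    and XY: "\<And>l x. l < g \<Longrightarrow> (X ! l) (E x) = E ((Y ! l) x)"
  shows "compress E X = Y"
proof (intro nth_equalityI ext)
  fix l x assume "l < length (compress E X)"
  then have l: "l < g" by (simp add: X)
  then show "(compress E X ! l) x = (Y ! l) x"
    using bop_idop_left[OF sa_tuples_bop[OF Y l]]
    by (simp add: compress_nth X XY isometry_op_adj[OF E])
qed (simp add: X sa_tuples_length[OF Y])

text \<open>A reducing subspace of X reduces every polynomial in X, so \<open>E\<close> also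
  intertwines \<Gamma>(Y) with \<Gamma>(X). Compressing both relations by \<open>E\<close> gives the
  two sides of the \<Gamma>-pair equation.\<close>

lemma gamma_pair_intertwine:
  assumes E: "isometry_op S T E" and Y: "Y \<in> sa_tuples g S" and X: "X \<in> sa_tuples g T"
    and XY: "\<And>l x. l < g \<Longrightarrow> (X ! l) (E x) = E ((Y ! l) x)"
    and \<Gamma>: "\<forall>p\<in>set \<Gamma>. p \<in> free_algebra g"
  shows "gamma_pair g \<Gamma> S T X E"
proof -
  note Y_eq = compress_intertwine[OF E Y sa_tuples_length[OF X] XY]
  have "compress E (eval_tuple T \<Gamma> X) = eval_tuple S \<Gamma> Y"
  proof (intro nth_equalityI ext)
    fix l x assume "l < length (compress E (eval_tuple T \<Gamma> X))"
    then have l: "l < length \<Gamma>" by simp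
    then have p: "\<Gamma> ! l \<in> free_algebra g" using \<Gamma> by simp
    show "(compress E (eval_tuple T \<Gamma> X) ! l) x = (eval_tuple S \<Gamma> Y ! l) x"
      using l bop_idop_left[OF eval_poly_bop[OF Y p]]
      by (simp add: compress_nth isometry_op_adj[OF E]
          eval_poly_intertwine[OF isometry_op_bop[OF E] p XY])
  qed simp
  with Y_eq show ?thesis
    using X E by (simp add: gamma_pair_def)
qed

section \<open>Direct sums\<close>

definition emb :: "nat \<Rightarrow> nat ell2 \<Rightarrow> (nat \<times> nat) ell2"
  where "emb i x = Abs_ell2 (\<lambda>(i', j). if i' = i then coord x j else 0)"

lemma coord_emb: "coord (emb i x) (i', j) = (if i' = i then coord x j else 0)"
proof -
  have "(\<lambda>p. (cmod (coord x (snd p)))\<^sup>2) summable_on Pair i ` UNIV"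
    by (subst summable_on_reindex) (auto simp: inj_on_def o_def coord_summable)
  then have "(\<lambda>p. (cmod (case p of (i', j) \<Rightarrow> if i' = i then coord x j else 0))\<^sup>2) summable_on UNIV"
    by (rule summable_on_cong_neutral[THEN iffD1, rotated -1]) (auto split: if_splits)
  then show ?thesis
    by (simp add: emb_def coord_Abs_ell2)
qed

lemma coord_component: "coord (component i x) j = coord x (i, j)"
proof -
  have "(\<lambda>p. (cmod (coord x p))\<^sup>2) summable_on Pair i ` UNIV"
    by (rule summable_on_subset_banach[OF coord_summable]) simp
  then have "(\<lambda>j. (cmod (coord x (i, j)))\<^sup>2) summable_on UNIV"
    by (subst (asm) summable_on_reindex) (auto simp: inj_on_def o_def)
  then show ?thesis
    by (simp add: component_def coord_Abs_ell2)
qed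

lemma component_eqI: "(\<And>i. component i x = component i y) \<Longrightarrow> x = y"
  by (rule ell2_eqI) (metis coord_component surj_pair)

lemma component_emb: "component i (emb j x) = (if i = j then x else 0)"
  by (rule ell2_eqI) (simp add: coord_component coord_emb coord_zero)

lemma cinner_emb: "cinner (emb i x) y = cinner x (component i y)"
proof -
  have "cinner (emb i x) y = (\<Sum>\<^sub>\<infinity>p\<in>Pair i ` UNIV. coord x (snd p) * cnj (coord y p))"
    unfolding cinner_def by (rule infsum_cong_neutral) (auto simp: coord_emb split: if_splits)
  also have "\<dots> = cinner x (component i y)"
    unfolding cinner_def by (subst infsum_reindex) (auto simp: inj_on_def o_def coord_component)
  finally show ?thesis .
qed

lemma cinner_component: "cinner (component i x) y = cinner x (emb i y)"
  by (metis cinner_commute cinner_emb)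

lemma norm_emb: "norm (emb i x) = norm x"
proof -
  have "complex_of_real ((norm (emb i x))\<^sup>2) = of_real ((norm x)\<^sup>2)"
    unfolding cinner_self[symmetric] by (simp add: cinner_emb component_emb)
  then show ?thesis
    by (metis of_real_eq_iff power2_eq_iff_nonneg norm_ge_zero)
qed

lemma emb_clinear: "clinear_op (emb i)"
  by (rule clinear_op_formal_adjointI[where C = 1, OF cinner_emb]) (simp add: norm_emb)

lemma component_clinear: "clinear_op (component i)"
proof (rule clinear_op_formal_adjointI[where C = 1, OF cinner_component])
  show "norm (component i x) \<le> 1 * norm x" for x
    using norm_le_of_cinner[of "component i x" x "emb i (component i x)"]
    by (simp add: cinner_component norm_emb)
qed

lemma adj_component: "adj (component i) = emb i"
  by (rule adj_eqI) (rule cinner_component)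

text \<open>Bessel's inequality: \<open>y\<close> is the orthogonal projection of \<open>x\<close>
  onto the summands in \<open>G\<close>, and a projection does not increase the norm.\<close>

lemma sum_norm_component_le:
  assumes "finite G"
  shows "(\<Sum>i\<in>G. (norm (component i x))\<^sup>2) \<le> (norm x)\<^sup>2"
proof -
  define y where "y = (\<Sum>i\<in>G. emb i (component i x))"
  have comp: "component i y = (if i \<in> G then component i x else 0)" for i
    using assms by (simp add: y_def clinear_op_sum[OF component_clinear] component_emb)
  have yy: "cinner y z = (\<Sum>i\<in>G. cinner (component i x) (component i z))" for z
    unfolding y_def by (simp add: cinner_sum_left cinner_emb)
  have "cinner y y = cinner y x"
    unfolding yy[of x] unfolding yy[of y] by (simp add: comp)
  then have "cinner y y = cinner x y"
    by (metis cinner_commute cinner_self complex_cnj_complex_of_real)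
  then have "norm y \<le> norm x"
    by (rule norm_le_of_cinner) simp
  moreover have "complex_of_real ((norm y)\<^sup>2) = of_real (\<Sum>i\<in>G. (norm (component i x))\<^sup>2)"
    unfolding cinner_self[symmetric] yy[of y] of_real_sum by (simp add: comp)
  ultimately show ?thesis
    by (metis norm_ge_zero of_real_eq_iff power_mono)
qed

lemma sum_norm_coord_le:
  assumes "finite F"
  shows "(\<Sum>j\<in>F. (cmod (coord x j))\<^sup>2) \<le> (norm x)\<^sup>2"
  using norm_idop_finite[OF assms, of x] norm_idop_le[of F x]
  by (metis norm_ge_zero power_mono)

section \<open>Orthogonal sums of uniformly bounded families of operators\<close>

context
  fixes I :: "nat set" and A :: "nat \<Rightarrow> op" and C :: real
  assumes clin: "\<And>i. i \<in> I \<Longrightarrow> clinear_op (A i)"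
    and bound: "\<And>i. i \<in> I \<Longrightarrow> onorm (A i) \<le> C"
begin

private definition "dsum_coord x = (\<lambda>(i, j). if i \<in> I then coord (A i (component i x)) j else 0)"

text \<open>The finite index set is enlarged to a rectangle; each row is bounded by the norm of one
  block, and Bessel's inequality adds up the rows. The absolute value covers an empty
  \<open>I\<close>, for which \<open>C\<close> may be negative.\<close>

lemma dsum_coord_bound:
  assumes "finite F"
  shows "(\<Sum>p\<in>F. (cmod (dsum_coord x p))\<^sup>2) \<le> (\<bar>C\<bar> * norm x)\<^sup>2"
proof -
  let ?f = "\<lambda>p. (cmod (dsum_coord x p))\<^sup>2"
  have "(\<Sum>p\<in>F. ?f p) \<le> (\<Sum>p\<in>fst ` F \<times> snd ` F. ?f p)"
    using assms by (intro sum_mono2) (auto simp: image_iff, force+)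
  also have "\<dots> = (\<Sum>i\<in>fst ` F. \<Sum>j\<in>snd ` F. ?f (i, j))"
    by (simp add: sum.cartesian_product)
  also have "\<dots> \<le> (\<Sum>i\<in>fst ` F. C\<^sup>2 * (norm (component i x))\<^sup>2)"
  proof (rule sum_mono)
    fix i
    show "(\<Sum>j\<in>snd ` F. ?f (i, j)) \<le> C\<^sup>2 * (norm (component i x))\<^sup>2"
    proof (cases "i \<in> I")
      case True
      have "norm (A i (component i x)) \<le> onorm (A i) * norm (component i x)"
        using clin[OF True] by (intro onorm) (simp add: clinear_op_iff)
      also have "\<dots> \<le> C * norm (component i x)"
        using bound[OF True] by (intro mult_right_mono) auto
      finally have "(norm (A i (component i x)))\<^sup>2 \<le> C\<^sup>2 * (norm (component i x))\<^sup>2"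
        using power_mono[of _ _ 2] by (fastforce simp: power_mult_distrib)
      moreover have "(\<Sum>j\<in>snd ` F. ?f (i, j)) \<le> (norm (A i (component i x)))\<^sup>2"
        using True assms by (simp add: dsum_coord_def sum_norm_coord_le)
      ultimately show ?thesis by linarith
    qed (simp add: dsum_coord_def)
  qed
  also have "\<dots> \<le> C\<^sup>2 * (norm x)\<^sup>2"
    unfolding sum_distrib_left[symmetric]
    using assms by (intro mult_left_mono sum_norm_component_le) auto
  finally show ?thesis by (simp add: power_mult_distrib)
qed

lemma dsum_coord_summable: "(\<lambda>p. (cmod (dsum_coord x p))\<^sup>2) summable_on UNIV"
  using dsum_coord_bound by (intro nonneg_bdd_above_summable_on) (auto simp: bdd_above_def)

lemma coord_dsum_op: "coord (dsum_op I A x) p = dsum_coord x p"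
  unfolding dsum_op_def
  using coord_Abs_ell2[OF dsum_coord_summable, of x p] by (simp add: dsum_coord_def)

lemma component_dsum_op:
  "component i (dsum_op I A x) = (if i \<in> I then A i (component i x) else 0)"
  by (rule ell2_eqI) (simp add: coord_component coord_dsum_op dsum_coord_def coord_zero)

lemma norm_dsum_op_le: "norm (dsum_op I A x) \<le> \<bar>C\<bar> * norm x"
proof -
  have "(norm (dsum_op I A x))\<^sup>2 = (\<Sum>\<^sub>\<infinity>p. (cmod (dsum_coord x p))\<^sup>2)"
    unfolding power2_norm_eq_inner[of "dsum_op I A x"] inner_ell2_self coord_dsum_op ..
  also have "\<dots> \<le> (\<bar>C\<bar> * norm x)\<^sup>2"
    by (intro infsum_le_finite_sums dsum_coord_summable dsum_coord_bound)
  finally show ?thesis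
    by (rule power2_le_imp_le) simp
qed

end

text \<open>Summation over pairs is iterated, which is legitimate by absolute convergence of the
  product. This reduces self-adjointness of an infinite direct sum to its blocks.\<close>

lemma cinner_prod: "cinner x y = (\<Sum>\<^sub>\<infinity>i. cinner (component i x) (component i y))"
proof -
  have "(\<lambda>(i, j). coord x (i, j) * cnj (coord y (i, j))) summable_on UNIV \<times> UNIV"
    using ell2_prod_summable[of x y] by (simp add: case_prod_beta')
  from infsum_Sigma'_banach[OF this] show ?thesis
    unfolding cinner_def coord_component by (simp add: case_prod_beta')
qed

lemma component_idop:
  "component i (idop (sum_idx I m) x) = (if i \<in> I then idop (idx (m i)) (component i x) else 0)"
  by (rule ell2_eqI) (auto simp: coord_component sum_idx_def coord_zero)

lemma dsum_op_selfadjoint: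
  assumes A: "\<And>i. i \<in> I \<Longrightarrow> A i \<in> bop (idx (m i)) (idx (m i)) \<and> adj (A i) = A i \<and> onorm (A i) \<le> C"
  shows "dsum_op I A \<in> bop (sum_idx I m) (sum_idx I m)" "adj (dsum_op I A) = dsum_op I A"
proof -
  have clin: "\<And>i. i \<in> I \<Longrightarrow> clinear_op (A i)" and bound: "\<And>i. i \<in> I \<Longrightarrow> onorm (A i) \<le> C"
    using A by (auto intro: bop_clinear)
  note comp = component_dsum_op[OF clin bound]
  have sa: "cinner (A i x) y = cinner x (A i y)" if "i \<in> I" for i x y
    using cinner_adj[OF clin[OF that]] A[OF that] by simp
  have adj: "cinner (dsum_op I A x) y = cinner x (dsum_op I A y)" for x y
    unfolding cinner_prod by (intro infsum_cong) (simp add: comp sa)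
  then have "clinear_op (dsum_op I A)"
    by (rule clinear_op_formal_adjointI[OF _ norm_dsum_op_le[OF clin bound]])
  moreover have "dsum_op I A (idop (sum_idx I m) x) = dsum_op I A x" for x
    by (rule component_eqI) (simp add: comp component_idop bop_idop_right[OF conjunct1[OF A]])
  moreover have "idop (sum_idx I m) (dsum_op I A x) = dsum_op I A x" for x
    by (rule component_eqI) (simp add: comp component_idop bop_idop_left[OF conjunct1[OF A]])
  ultimately show "dsum_op I A \<in> bop (sum_idx I m) (sum_idx I m)"
    by (simp add: bop_iff)
  show "adj (dsum_op I A) = dsum_op I A"
    by (rule adj_eqI) (rule adj)
qed

section \<open>Direct sums of tuples and columns of coefficients\<close>

lemma length_dsum [simp]: "length (dsum g I X) = g"
  by (simp add: dsum_def)

lemma dsum_nth [simp]: "l < g \<Longrightarrow> dsum g I X ! l = dsum_op I (\<lambda>i. X i ! l)"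
  by (simp add: dsum_def)

lemma dsum_sa_tuples:
  assumes X: "\<forall>i\<in>I. X i \<in> sa_tuples g (idx (m i))"
    and C: "\<forall>i\<in>I. \<forall>A\<in>set (X i). onorm A \<le> C"
  shows "dsum g I X \<in> sa_tuples g (sum_idx I m)"
proof -
  have "X i ! l \<in> bop (idx (m i)) (idx (m i)) \<and> adj (X i ! l) = X i ! l \<and> onorm (X i ! l) \<le> C"
    if "i \<in> I" "l < g" for i l
    using X C that by (auto simp: sa_tuples_iff)
  then show ?thesis
    by (auto simp: sa_tuples_iff intro!: dsum_op_selfadjoint[of I _ m C])
qed

lemma component_dsum:
  assumes X: "\<forall>i\<in>I. X i \<in> sa_tuples g (idx (m i))"
    and C: "\<forall>i\<in>I. \<forall>A\<in>set (X i). onorm A \<le> C" and l: "l < g"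
  shows "component i ((dsum g I X ! l) x) = (if i \<in> I then (X i ! l) (component i x) else 0)"
proof -
  have "clinear_op (X i ! l) \<and> onorm (X i ! l) \<le> C" if "i \<in> I" for i
    using X C that l by (auto simp: sa_tuples_iff intro: bop_clinear)
  then show ?thesis
    unfolding dsum_nth[OF l] by (intro component_dsum_op[where C = C]) auto
qed

text \<open>Each letter acts blockwise, hence so do words and polynomials. This evaluates \<Gamma>
  on the direct sum that occurs in the definition of a \<Gamma>-extreme point.\<close>

lemma component_eval_poly_dsum:
  assumes X: "\<forall>i\<in>I. X i \<in> sa_tuples g (idx (m i))"
    and C: "\<forall>i\<in>I. \<forall>A\<in>set (X i). onorm A \<le> C"
    and p: "p \<in> free_algebra g" and i: "i \<in> I"
  shows "component i (eval_poly (sum_idx I m) p (dsum g I X) x)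
    = eval_poly (idx (m i)) p (X i) (component i x)"
proof -
  have "component i (eval_word (sum_idx I m) (dsum g I X) w x)
      = eval_word (idx (m i)) (X i) w (component i x)" if "w \<in> lists {..<g}" for w
    using that
  proof (induction w)
    case (Cons j w)
    then show ?case
      using component_dsum[OF X C, of j i] i by simp
  qed (simp add: component_idop i)
  then show ?thesis
    unfolding eval_poly_def using free_algebra_key[OF p]
    by (auto simp: clinear_op_sum[OF component_clinear] clinear_op_scaleC[OF component_clinear]
        intro!: sum.cong)
qed

text \<open>The finite sum of embedded vectors certifies that the family on the right is square
  summable, so \<open>Abs_ell2\<close> returns the intended vector. Afterwards \<open>col\<close>
  can be handled as this sum.\<close>

lemma coord_sum_emb:
  "(\<Sum>i<k. emb i (V i x)) = Abs_ell2 (\<lambda>(i, j). if i < k then coord (V i x) j else 0)"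
proof (rule ell2_eqI)
  fix p :: "nat \<times> nat"
  obtain i j where p: "p = (i, j)" by fastforce
  have c: "coord (\<Sum>i<k. emb i (V i x)) (i, j) = (if i < k then coord (V i x) j else 0)" for i j
    by (simp add: coord_sum coord_emb)
  have "(\<lambda>p. (cmod (case p of (i, j) \<Rightarrow> if i < k then coord (V i x) j else 0))\<^sup>2) summable_on UNIV"
    using coord_summable[of "\<Sum>i<k. emb i (V i x)"]
    by (rule summable_on_cong[THEN iffD1, rotated]) (auto simp: c)
  then show "coord (\<Sum>i<k. emb i (V i x)) p
      = coord (Abs_ell2 (\<lambda>(i, j). if i < k then coord (V i x) j else 0)) p"
    by (simp add: coord_Abs_ell2 p c)
qed

lemma col_eq_sum_emb: "col k V x = (\<Sum>i<k. emb i (V i x))"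
  by (simp add: col_def coord_sum_emb)

lemma adj_col:
  assumes "\<And>i. i < k \<Longrightarrow> clinear_op (V i)"
  shows "adj (col k V) = (\<lambda>y. \<Sum>i<k. adj (V i) (component i y))"
  by (rule adj_eqI)
    (auto simp: col_eq_sum_emb cinner_sum_left cinner_sum_right cinner_emb cinner_adj[OF assms]
      intro!: sum.cong)

lemma component_col: "i < k \<Longrightarrow> component i (col k V x) = V i x"
  by (simp add: col_eq_sum_emb clinear_op_sum[OF component_clinear] component_emb)

section \<open>Operator convex sets\<close>

lemma idx_eq_empty: "idx n = {} \<longleftrightarrow> n = 0"
proof
  assume "idx n = {}"
  then have "\<not> enat 0 < n" by (auto simp: idx_def)
  then show "n = 0" by (simp add: zero_enat_def[symmetric])
qed (simp add: idx_def)

text \<open>Out of the zero space \<open>U\<close> is zero, so \<open>idop T\<close>, being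
  \<open>U\<close> after its adjoint, vanishes too. This keeps direct sums away from level
  0.\<close>

lemma unitary_op_nonempty:
  assumes U: "unitary_op S T U" and T: "T \<noteq> {}"
  shows "S \<noteq> {}"
proof
  assume S: "S = {}"
  have U': "U \<in> bop S T"
    by (rule isometry_op_bop[OF unitary_op_isometry[OF U]])
  have "idop S x = 0" for x :: "'a ell2"
    by (rule ell2_eqI) (simp add: S coord_zero)
  then have "U x = 0" for x
    using bop_idop_right[OF U', of x] by (simp add: clinear_op_zero[OF bop_clinear[OF U']])
  then have "idop T = (\<lambda>_. 0)"
    using unitary_op_right[OF U] by auto
  then show False
    using idop_eq_zeroD T by blast
qed

lemma length_convex_comb [simp]: "length (convex_comb g k V X) = g"
  by (simp add: convex_comb_def)

lemma convex_comb_nth [simp]: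
  "l < g \<Longrightarrow> convex_comb g k V X ! l = (\<lambda>x. \<Sum>i<k. adj (V i) ((X i ! l) (V i x)))"
  by (simp add: convex_comb_def)

lemma convex_coeffs_bop: "convex_coeffs k n m V \<Longrightarrow> i < k \<Longrightarrow> V i \<in> bop (idx n) (idx (m i))"
  by (simp add: convex_coeffs_def)

lemma convex_coeffs_sum:
  "convex_coeffs k n m V \<Longrightarrow> (\<Sum>i<k. adj (V i) (V i x)) = idop (idx n) x"
  by (simp add: convex_coeffs_def fun_eq_iff)

lemma graded_set_sa_tuples: "graded_set g J \<Longrightarrow> X \<in> J n \<Longrightarrow> X \<in> sa_tuples g (idx n)"
  by (auto simp: graded_set_def)

lemma graded_set_level: "graded_set g J \<Longrightarrow> X \<in> J n \<Longrightarrow> n \<noteq> 0"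
  by (auto simp: graded_set_def)

lemma operator_convex_graded_set: "operator_convex g J \<Longrightarrow> graded_set g J"
  by (simp add: operator_convex_def free_set_def)

lemma operator_convex_unitary:
  "operator_convex g J \<Longrightarrow> X \<in> J n \<Longrightarrow> unitary_op (idx n) (idx n) U \<Longrightarrow> compress U X \<in> J n"
  by (simp add: operator_convex_def free_set_def)

lemma operator_convex_dsum:
  assumes "operator_convex g J" "I \<noteq> {}" "\<forall>i\<in>I. X i \<in> J (m i)"
    "\<forall>i\<in>I. \<forall>A\<in>set (X i). onorm A \<le> C" "unitary_op (idx n) (sum_idx I m) U"
  shows "compress U (dsum g I X) \<in> J n"
  using assms unfolding operator_convex_def free_set_def by blast

lemma operator_convex_comb:
  "operator_convex g J \<Longrightarrow> n \<noteq> 0 \<Longrightarrow> \<forall>i<k. X i \<in> J (m i) \<Longrightarrow> convex_coeffs k n m V \<Longrightarrow>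
    convex_comb g k V X \<in> J n"
  unfolding operator_convex_def by blast

lemma operator_convexI:
  assumes "graded_set g J"
    and "\<And>n X U. X \<in> J n \<Longrightarrow> unitary_op (idx n) (idx n) U \<Longrightarrow> compress U X \<in> J n"
    and "\<And>I m X n U C. I \<noteq> {} \<Longrightarrow> \<forall>i\<in>I. X i \<in> J (m i) \<Longrightarrow>
      \<forall>i\<in>I. \<forall>A\<in>set (X i). onorm A \<le> C \<Longrightarrow> unitary_op (idx n) (sum_idx I m) U \<Longrightarrow>
      compress U (dsum g I X) \<in> J n"
    and "\<And>n k m V X. n \<noteq> 0 \<Longrightarrow> \<forall>i<k. X i \<in> J (m i) \<Longrightarrow> convex_coeffs k n m V \<Longrightarrow>
      convex_comb g k V X \<in> J n"
  shows "operator_convex g J"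
  unfolding operator_convex_def free_set_def
  by (intro conjI allI impI; (elim conjE exE)?) (rule assms; assumption)+

section \<open>The operator convex hull\<close>

definition all_tuples :: "nat \<Rightarrow> graded"
  where "all_tuples g n = (if n = 0 then {} else sa_tuples g (idx n))"

lemma all_tuples_iff: "X \<in> all_tuples g n \<longleftrightarrow> n \<noteq> 0 \<and> X \<in> sa_tuples g (idx n)"
  by (simp add: all_tuples_def)

text \<open>This is the largest graded set; it confines the hull to self-adjoint tuples at nonzero
  levels.\<close>

lemma operator_convex_all_tuples: "operator_convex g (all_tuples g)"
proof (rule operator_convexI)
  show "graded_set g (all_tuples g)"
    by (auto simp: graded_set_def all_tuples_def)
next
  fix n X U assume "X \<in> all_tuples g n" "unitary_op (idx n) (idx n) U"
  then show "compress U X \<in> all_tuples g n"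
    by (auto simp: all_tuples_iff
        intro: compress_sa_tuples[OF isometry_op_bop[OF unitary_op_isometry]])
next
  fix I m X n U C
  assume I: "I \<noteq> {}" and X: "\<forall>i\<in>I. X i \<in> all_tuples g (m i)"
    and C: "\<forall>i\<in>I. \<forall>A\<in>set (X i). onorm A \<le> C" and U: "unitary_op (idx n) (sum_idx I m) U"
  have "sum_idx I m \<noteq> {}"
    using I X idx_eq_empty by (auto simp: all_tuples_iff sum_idx_def)
  then have "n \<noteq> 0"
    using unitary_op_nonempty[OF U] by (simp add: idx_eq_empty)
  moreover have "dsum g I X \<in> sa_tuples g (sum_idx I m)"
    using X by (intro dsum_sa_tuples[OF _ C]) (simp add: all_tuples_iff)
  ultimately show "compress U (dsum g I X) \<in> all_tuples g n"
    using compress_sa_tuples[OF isometry_op_bop[OF unitary_op_isometry[OF U]]]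
    by (simp add: all_tuples_iff)
next
  fix n k m V X
  assume "n \<noteq> 0" and X: "\<forall>i<k. X i \<in> all_tuples g (m i)" and V: "convex_coeffs k n m V"
  have "convex_comb g k V X ! l \<in> bop (idx n) (idx n) \<and>
      adj (convex_comb g k V X ! l) = convex_comb g k V X ! l" if l: "l < g" for l
    using sum_compress_selfadjoint[of "{..<k}" V "idx n" "\<lambda>i. idx (m i)" "\<lambda>i. X i ! l"]
      convex_coeffs_bop[OF V] X l
    by (simp add: all_tuples_iff sa_tuples_iff)
  then show "convex_comb g k V X \<in> all_tuples g n"
    using \<open>n \<noteq> 0\<close> by (simp add: all_tuples_iff sa_tuples_iff)
qed

lemma opco_iff:
  "X \<in> opco g S n \<longleftrightarrow> (\<forall>J. operator_convex g J \<and> (\<forall>p. S p \<subseteq> J p) \<longrightarrow> X \<in> J n)"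
  by (auto simp: opco_def)

lemma opco_superset: "S p \<subseteq> opco g S p"
  by (rule subsetI) (unfold opco_iff, blast)

lemma opco_subset: "operator_convex g J \<Longrightarrow> (\<And>p. S p \<subseteq> J p) \<Longrightarrow> opco g S n \<subseteq> J n"
  by (auto simp: opco_iff)

text \<open>Without the hypothesis \<open>S \<subseteq> all_tuples g\<close> the intersection defining the hull could be empty.\<close>

lemma operator_convex_opco:
  assumes "\<And>p. S p \<subseteq> all_tuples g p"
  shows "operator_convex g (opco g S)"
proof (rule operator_convexI)
  have "opco g S n \<subseteq> all_tuples g n" for n
    by (rule opco_subset[OF operator_convex_all_tuples assms])
  then show "graded_set g (opco g S)"
    by (fastforce simp: graded_set_def all_tuples_iff)
next
  fix n X U assume "X \<in> opco g S n" "unitary_op (idx n) (idx n) U"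
  then show "compress U X \<in> opco g S n"
    by (auto simp: opco_iff intro!: operator_convex_unitary)
next
  fix I m X n U C
  assume "I \<noteq> {}" "\<forall>i\<in>I. X i \<in> opco g S (m i)" "\<forall>i\<in>I. \<forall>A\<in>set (X i). onorm A \<le> C"
    "unitary_op (idx n) (sum_idx I m) U"
  then show "compress U (dsum g I X) \<in> opco g S n"
    unfolding opco_iff by (blast intro: operator_convex_dsum)
next
  fix n k m V X
  assume "n \<noteq> 0" "\<forall>i<k. X i \<in> opco g S (m i)" "convex_coeffs k n m V"
  then show "convex_comb g k V X \<in> opco g S n"
    unfolding opco_iff by (blast intro: operator_convex_comb)
qed

section \<open>Direct summands and free extreme points\<close>

text \<open>For self-adjoint \<open>Y\<close> the intertwining relation says that the range of \<open>W\<close> reduces \<open>Y\<close>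
  and that \<open>Y\<close> restricts there to a unitary copy of \<open>Z\<close>.\<close>

definition has_summand :: "nat \<Rightarrow> enat \<Rightarrow> op list \<Rightarrow> enat \<Rightarrow> op list \<Rightarrow> bool"
  where "has_summand g n Z m Y \<longleftrightarrow> (\<exists>W. isometry_op (idx n) (idx m) W \<and>
    (\<forall>l<g. \<forall>x. (Y ! l) (W x) = W ((Z ! l) x)))"

lemma has_summandI:
  "isometry_op (idx n) (idx m) W \<Longrightarrow> (\<And>l x. l < g \<Longrightarrow> (Y ! l) (W x) = W ((Z ! l) x)) \<Longrightarrow>
    has_summand g n Z m Y"
  unfolding has_summand_def by blast

lemma has_summand_self:
  assumes "Z \<in> sa_tuples g (idx n)"
  shows "has_summand g n Z n Z"
  by (rule has_summandI[OF isometry_op_idop])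
    (simp add: bop_idop_left[OF sa_tuples_bop[OF assms]] bop_idop_right[OF sa_tuples_bop[OF assms]])

text \<open>The block formulas are traded for intertwining relations, which say that the ranges of
  \<open>E\<close> and \<open>F\<close> reduce \<open>A\<close>. Only these relations survive well
  under polynomials and compressions.\<close>

lemma splitsE:
  assumes sp: "splits J V m A n X" and J: "graded_set g J"
  obtains p Y E where "Y \<in> J p" "unitarily_equiv p Y n X" "isometry_op (idx p) (idx m) E"
    "range E = range V" "\<forall>l<g. \<forall>x. (A ! l) (E x) = E ((Y ! l) x)"
    "range V = hil (idx m) \<Longrightarrow> A = map (\<lambda>B. E \<circ> B \<circ> adj E) Y"
    "range V \<noteq> hil (idx m) \<Longrightarrow> \<exists>q Z F. Z \<in> J q \<and> isometry_op (idx q) (idx m) F \<and>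
      range F = {y \<in> hil (idx m). \<forall>x. cinner (V x) y = 0} \<and>
      A = map2 (\<lambda>B C x. E (B (adj E x)) + F (C (adj F x))) Y Z \<and>
      (\<forall>l<g. \<forall>x. (A ! l) (F x) = F ((Z ! l) x))"
proof -
  from sp obtain p Y E where Y: "Y \<in> J p" "unitarily_equiv p Y n X"
    and E: "isometry_op (idx p) (idx m) E" "range E = range V"
    and A: "if range V = hil (idx m)
        then A = map (\<lambda>B. E \<circ> B \<circ> adj E) Y
        else \<exists>q Z F. Z \<in> J q \<and> isometry_op (idx q) (idx m) F \<and>
          range F = {y \<in> hil (idx m). \<forall>x. cinner (V x) y = 0} \<and>
          A = map2 (\<lambda>B C x. E (B (adj E x)) + F (C (adj F x))) Y Z"
    unfolding splits_def by blast
  note Ysa = graded_set_sa_tuples[OF J Y(1)]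
  note Ec = bop_clinear[OF isometry_op_bop[OF E(1)]]
  show ?thesis
  proof (cases "range V = hil (idx m)")
    case True
    then have A: "A = map (\<lambda>B. E \<circ> B \<circ> adj E) Y" using A by simp
    show ?thesis
      by (rule that[OF Y E])
        (simp_all add: True A sa_tuples_length[OF Ysa] isometry_op_adj[OF E(1)]
          bop_idop_right[OF sa_tuples_bop[OF Ysa]])
  next
    case False
    then obtain q Z F where Z: "Z \<in> J q" and F: "isometry_op (idx q) (idx m) F"
      and rF: "range F = {y \<in> hil (idx m). \<forall>x. cinner (V x) y = 0}"
      and A: "A = map2 (\<lambda>B C x. E (B (adj E x)) + F (C (adj F x))) Y Z"
      using A by auto
    note Zsa = graded_set_sa_tuples[OF J Z]
    note Fc = bop_clinear[OF isometry_op_bop[OF F]]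
    \<comment> \<open>The range of \<open>F\<close> is orthogonal to that of \<open>V\<close>, which
      is the range of \<open>E\<close>; this removes the cross terms in the block formula.\<close>
    have EF: "cinner (E x) (F y) = 0" for x y
    proof -
      have "E x \<in> range V" "F y \<in> range F" using E(2) by auto
      then show ?thesis unfolding rF by auto
    qed
    have FE: "cinner (F y) (E x) = 0" for x y
      using EF by (metis cinner_commute complex_cnj_zero)
    have adjEF: "adj E (F x) = 0" for x
      by (rule cinner_eqI) (simp add: cinner_adj'[OF Ec] FE)
    have adjFE: "adj F (E x) = 0" for x
      by (rule cinner_eqI) (simp add: cinner_adj'[OF Fc] EF)
    have An: "(A ! l) x = E ((Y ! l) (adj E x)) + F ((Z ! l) (adj F x))" if "l < g" for l x
      using that by (simp add: A sa_tuples_length[OF Ysa] sa_tuples_length[OF Zsa])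
    have AE: "(A ! l) (E x) = E ((Y ! l) x)" if l: "l < g" for l x
      using sa_tuples_bop[OF Ysa l] sa_tuples_bop[OF Zsa l]
      by (simp add: An[OF l] adjFE isometry_op_adj[OF E(1)] bop_idop_right bop_clinear
          clinear_op_zero[of "Z ! l"] clinear_op_zero[OF Fc])
    have AF: "(A ! l) (F x) = F ((Z ! l) x)" if l: "l < g" for l x
      using sa_tuples_bop[OF Ysa l] sa_tuples_bop[OF Zsa l]
      by (simp add: An[OF l] adjEF isometry_op_adj[OF F] bop_idop_right bop_clinear
          clinear_op_zero[of "Y ! l"] clinear_op_zero[OF Ec])
    show ?thesis
      by (rule that[OF Y E]) (use False Z F rF A AE AF in blast)+
  qed
qed

text \<open>Since \<open>c\<close> is nonzero, \<open>W\<close> has the same range as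
  \<open>V\<close>, which is invariant under \<open>A\<close> by the splitting. So \<open>A\<close>
  maps \<open>W x\<close> to some \<open>W u\<close>, and applying the adjoint of \<open>W\<close>
  identifies \<open>u\<close> through the compression of \<open>A\<close>.\<close>

lemma splits_has_summand:
  assumes sp: "splits J V m A n X" and J: "graded_set g J" and A: "A \<in> J m"
    and W: "isometry_op (idx n) (idx m) W" and V: "V = (\<lambda>x. c *\<^sub>C W x)" "V \<noteq> (\<lambda>_. 0)"
    and X: "compress W A = X"
  shows "has_summand g n X m A"
proof (rule has_summandI[OF W])
  fix l x assume l: "l < g"
  obtain Y and E :: op where E: "range E = range V" "\<forall>l<g. \<forall>x. (A ! l) (E x) = E ((Y ! l) x)"
    using sp J by (rule splitsE)
  have c: "c \<noteq> 0" using V by auto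
  have "range V = range W"
  proof (rule set_eqI)
    fix y
    have "W x = V (inverse c *\<^sub>C x)" for x
      using c by (simp add: V(1) clinear_op_scaleC[OF bop_clinear[OF isometry_op_bop[OF W]]])
    moreover have "V x = W (c *\<^sub>C x)" for x
      by (simp add: V(1) clinear_op_scaleC[OF bop_clinear[OF isometry_op_bop[OF W]]])
    ultimately show "y \<in> range V \<longleftrightarrow> y \<in> range W" by (metis rangeE rangeI)
  qed
  with E(1) have rng: "range E = range W" by simp
  then obtain z where "W x = E z" by (metis rangeE rangeI)
  then have "(A ! l) (W x) \<in> range W" using E(2) l by (simp flip: rng)
  then obtain u where u: "(A ! l) (W x) = W u" by auto
  have "(X ! l) x = adj W (W u)"
    using l sa_tuples_length[OF graded_set_sa_tuples[OF J A]]
    by (simp add: X[symmetric] compress_nth u)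
  then show "(A ! l) (W x) = W ((X ! l) x)"
    by (simp add: u isometry_op_adj[OF W] bop_idop_right[OF isometry_op_bop[OF W]])
qed

section \<open>Extremality and summands of convex combinations\<close>

lemma free_extremeD:
  assumes Z: "Z \<in> free_extreme g J n" and A: "\<forall>i<k. A i \<in> J (m i) \<and> V i \<noteq> (\<lambda>_. 0)"
    and V: "convex_coeffs k n m V" and comb: "Z = convex_comb g k V A" and i: "i < k"
  obtains c W where "isometry_op (idx n) (idx (m i)) W" "V i = (\<lambda>x. c *\<^sub>C W x)"
    "compress W (A i) = Z" "splits J (V i) (m i) (A i) n Z"
proof -
  from Z have "\<forall>k m V A. (\<forall>i<k. A i \<in> J (m i) \<and> V i \<noteq> (\<lambda>_. 0)) \<and> convex_coeffs k n m V \<and>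
      Z = convex_comb g k V A \<longrightarrow>
      (\<forall>i<k. \<exists>c W. isometry_op (idx n) (idx (m i)) W \<and> V i = (\<lambda>x. c *\<^sub>C W x) \<and>
        compress W (A i) = Z \<and> splits J (V i) (m i) (A i) n Z)"
    unfolding free_extreme_def mem_Collect_eq by (rule conjunct2)
  from this[THEN spec[of _ k], THEN spec[of _ m], THEN spec[of _ V], THEN spec[of _ A]]
  show ?thesis
    using A V comb i that by blast
qed

text \<open>Free extremality speaks of combinations with nonzero coefficients only, so the vanishing
  terms are first dropped by enumerating the remaining indices as
  \<open>f 0, f 1, ...\<close>.\<close>

lemma free_extreme_has_summand:
  assumes Z: "Z \<in> free_extreme g J n" and J: "graded_set g J"
    and A: "\<forall>i<k. A i \<in> J (m i)" and V: "convex_coeffs k n m V"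
    and comb: "Z = convex_comb g k V A" and i: "i < k" "V i \<noteq> (\<lambda>_. 0)"
  shows "has_summand g n Z (m i) (A i)"
proof -
  define N where "N = {j. j < k \<and> V j \<noteq> (\<lambda>_. 0)}"
  have N: "finite N" "N \<subseteq> {..<k}" by (auto simp: N_def)
  then obtain f where f: "bij_betw f {..<card N} N"
    using ex_bij_betw_nat_finite[of N] by (metis lessThan_atLeast0)
  have fN: "f j < k" "V (f j) \<noteq> (\<lambda>_. 0)" if "j < card N" for j
    using bij_betwE[OF f] that by (auto simp: N_def)
  \<comment> \<open>The free \<open>h\<close> serves two sums at once: the identity gives the
    normalisation of the coefficients, and the entries of the points give the combination.\<close>
  have sum_eq: "(\<Sum>j<card N. adj (V (f j)) (h (f j) (V (f j) x)))
      = (\<Sum>j<k. adj (V j) (h j (V j x)))" if "\<And>j. j < k \<Longrightarrow> h j 0 = 0" for h x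
  proof -
    have "adj (V j) (h j (V j x)) = 0" if "j \<in> {..<k} - N" for j
    proof -
      have j: "j < k" "V j x = 0" using that by (auto simp: N_def)
      show ?thesis
        using \<open>\<And>j. j < k \<Longrightarrow> h j 0 = 0\<close>[OF j(1)] j(2)
          clinear_op_zero[OF adj_clinear[OF bop_clinear[OF convex_coeffs_bop[OF V j(1)]]]] by simp
    qed
    then have "(\<Sum>j\<in>N. adj (V j) (h j (V j x))) = (\<Sum>j<k. adj (V j) (h j (V j x)))"
      using N by (intro sum.mono_neutral_left) auto
    with sum.reindex_bij_betw[OF f, of "\<lambda>j. adj (V j) (h j (V j x))"] show ?thesis
      by (rule trans)
  qed
  have "convex_coeffs (card N) n (\<lambda>j. m (f j)) (\<lambda>j. V (f j))"
    using sum_eq[of "\<lambda>_ x. x"] convex_coeffs_sum[OF V] convex_coeffs_bop[OF V] fN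
    by (auto simp: convex_coeffs_def)
  moreover have "Z = convex_comb g (card N) (\<lambda>j. V (f j)) (\<lambda>j. A (f j))"
  proof (rule nth_equalityI)
    fix l assume "l < length Z"
    then have l: "l < g" by (simp add: comb)
    have "(A j ! l) 0 = 0" if "j < k" for j
      using clinear_op_zero bop_clinear sa_tuples_bop[OF graded_set_sa_tuples[OF J] l] A that by blast
    from sum_eq[of "\<lambda>j. A j ! l", OF this]
    show "Z ! l = convex_comb g (card N) (\<lambda>j. V (f j)) (\<lambda>j. A (f j)) ! l"
      using l by (simp add: comb)
  qed (simp add: comb)
  moreover have "\<forall>j<card N. A (f j) \<in> J (m (f j)) \<and> V (f j) \<noteq> (\<lambda>_. 0)"
    using fN A by blast
  moreover have "i \<in> f ` {..<card N}"
    using i bij_betw_imp_surj_on[OF f] by (simp add: N_def)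
  then obtain j where "j < card N" "f j = i"
    by auto
  ultimately obtain c W where W: "isometry_op (idx n) (idx (m i)) W" "V i = (\<lambda>x. c *\<^sub>C W x)"
    "compress W (A i) = Z" "splits J (V i) (m i) (A i) n Z"
    using free_extremeD[OF Z, of "card N" "\<lambda>j. A (f j)" "\<lambda>j. m (f j)" "\<lambda>j. V (f j)" j] by metis
  show ?thesis
    using splits_has_summand[OF W(4) J _ W(1,2) i(2) W(3)] A i by blast
qed

text \<open>Compressing the combination by \<open>W\<close> yields \<open>Z\<close> as a combination
  of the same points with coefficients \<open>V i\<close> after \<open>W\<close>. These are again
  normalised because \<open>W\<close> is an isometry, so extremality of \<open>Z\<close> applies to
  every point whose new coefficient is nonzero.\<close>

lemma convex_comb_has_summand:
  assumes Z: "Z \<in> free_extreme g J n" and J: "graded_set g J"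
    and A: "\<forall>i<k. A i \<in> J (m i)" and V: "convex_coeffs k p m V"
    and W: "isometry_op (idx n) (idx p) W"
    and AW: "\<And>l x. l < g \<Longrightarrow> (convex_comb g k V A ! l) (W x) = W ((Z ! l) x)"
    and i: "i < k" "V i (W x) \<noteq> 0"
  shows "has_summand g n Z (m i) (A i)"
proof -
  have "Z \<in> J n" using Z by (simp add: free_extreme_def)
  note Zsa = graded_set_sa_tuples[OF J this]
  note Wb = isometry_op_bop[OF W]
  note Wc = bop_clinear[OF Wb]
  define U where "U i x = V i (W x)" for i x
  have Vc: "clinear_op (V i)" if "i < k" for i
    by (rule bop_clinear[OF convex_coeffs_bop[OF V that]])
  have U: "U i \<in> bop (idx n) (idx (m i))" if "i < k" for i
    unfolding U_def by (rule bop_compose[OF convex_coeffs_bop[OF V that] Wb])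
  have adjU: "adj (U i) = (\<lambda>y. adj W (adj (V i) y))" if "i < k" for i
    unfolding U_def by (rule adj_compose[OF Vc[OF that] Wc])
  have sum_eq: "(\<Sum>i<k. adj (U i) (h i)) = adj W (\<Sum>i<k. adj (V i) (h i))" for h
    by (simp add: adjU clinear_op_sum[OF adj_clinear[OF Wc]])
  have "convex_coeffs k n m U"
    unfolding convex_coeffs_def sum_eq unfolding U_def convex_coeffs_sum[OF V]
    using U by (auto simp: bop_idop_left[OF Wb] isometry_op_adj[OF W] U_def[abs_def])
  moreover have "Z = convex_comb g k U A"
  proof (intro nth_equalityI ext)
    fix l x assume "l < length Z"
    then have l: "l < g" using sa_tuples_length[OF Zsa] by simp
    have "(convex_comb g k U A ! l) x = adj W ((convex_comb g k V A ! l) (W x))"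
      using l by (simp add: sum_eq) (simp add: U_def)
    also have "\<dots> = (Z ! l) x"
      by (simp add: AW[OF l] isometry_op_adj[OF W] bop_idop_left[OF sa_tuples_bop[OF Zsa l]] del: convex_comb_nth)
    finally show "(Z ! l) x = (convex_comb g k U A ! l) x" ..
  qed (simp add: sa_tuples_length[OF Zsa])
  moreover have "U i \<noteq> (\<lambda>_. 0)"
    using i by (auto simp: U_def fun_eq_iff)
  ultimately show ?thesis
    using free_extreme_has_summand[OF Z J A _ _ i(1)] by blast
qed

text \<open>Reusing \<open>Y\<close> itself as the second point, with the projection onto the complement of the \<open>i\<close>-th
  summand as coefficient, splits off one of infinitely many summands with a finite combination.\<close>

lemma dsum_eq_convex_comb:
  assumes i: "i \<in> I" and X: "\<forall>i\<in>I. X i \<in> sa_tuples g (idx (m i))"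
    and C: "\<forall>i\<in>I. \<forall>A\<in>set (X i). onorm A \<le> C"
    and U: "unitary_op (idx p) (sum_idx I m) U"
  defines "Y \<equiv> compress U (dsum g I X)"
    and "V \<equiv> \<lambda>j x. if j = (0::nat) then component i (U x)
      else adj U (U x - emb i (component i (U x)))"
  shows "convex_coeffs 2 p (\<lambda>j. if j = 0 then m i else p) V"
    and "Y = convex_comb g 2 V (\<lambda>j. if j = 0 then X i else Y)"
proof -
  let ?S = "sum_idx I m"
  \<comment> \<open>This is the projection onto the orthogonal complement of the \<open>i\<close>-th
    summand; the second coefficient is its conjugate by \<open>U\<close>, hence
    self-adjoint.\<close>
  define P where "P v = v - emb i (component i v)" for v
  note Ub = isometry_op_bop[OF unitary_op_isometry[OF U]]
  note Uc = bop_clinear[OF Ub]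
  have comp_P: "component j (P v) = (if j = i then 0 else component j v)" for j v
    by (simp add: P_def clinear_op_diff[OF component_clinear] component_emb)
  have id: "clinear_op (\<lambda>x :: (nat \<times> nat) ell2. x)"
    using idop_clinear[of UNIV] by simp
  have Pc: "clinear_op P"
    unfolding P_def[abs_def]
    by (rule clinear_op_diffI[OF id clinear_op_compose[OF emb_clinear component_clinear]])
  \<comment> \<open>The projection \<open>P\<close> preserves the image of \<open>U\<close>, so
    \<open>U\<close> after its adjoint acts on \<open>P (U x)\<close> as the identity.\<close>
  have P_idop: "idop ?S (P (U x)) = P (U x)" for x
  proof (rule component_eqI)
    fix j
    show "component j (idop ?S (P (U x))) = component j (P (U x))"
      using arg_cong[OF bop_idop_left[OF Ub, of x], of "component j"]
      by (auto simp: component_idop comp_P clinear_op_zero[OF idop_clinear])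
  qed
  have cinner_P: "cinner (P x) y = cinner x (P y)" for x y
    by (simp add: P_def cinner_diff_left cinner_diff_right cinner_emb cinner_component[symmetric])
  have V0: "V 0 = (\<lambda>x. component i (U x))"
    and V1: "V (Suc 0) = (\<lambda>x. adj U (P (U x)))"
    by (auto simp: V_def P_def)
  have adj_V0: "adj (V 0) = (\<lambda>y. adj U (emb i y))"
    unfolding V0 adj_compose[OF component_clinear Uc] adj_component ..
  have adj_V1: "adj (V (Suc 0)) = V (Suc 0)"
    unfolding V1 by (rule adj_eqI) (simp add: cinner_adj'[OF Uc] cinner_adj[OF Uc] cinner_P)
  have UU: "U (adj U (P (U x))) = P (U x)" for x
    by (simp add: unitary_op_right[OF U] P_idop)
  have PP: "P (P v) = P v" for v
    by (rule component_eqI) (simp add: comp_P)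
  have "V 0 \<in> bop (idx p) (idx (m i))"
    unfolding V0 bop_iff
  proof (intro conjI allI)
    show "clinear_op (\<lambda>x. component i (U x))"
      by (rule clinear_op_compose[OF component_clinear Uc])
    show "component i (U (idop (idx p) x)) = component i (U x)" for x
      by (simp add: bop_idop_right[OF Ub])
    show "idop (idx (m i)) (component i (U x)) = component i (U x)" for x
      using component_idop[of i I m "U x"] i by (simp add: bop_idop_left[OF Ub])
  qed
  moreover have "V (Suc 0) \<in> bop (idx p) (idx p)"
    unfolding V1 bop_iff
    using clinear_op_compose[OF adj_clinear[OF Uc] clinear_op_compose[OF Pc Uc]]
    by (simp add: bop_idop_right[OF Ub] bop_idop_left[OF adj_bop[OF Ub]])
  moreover have "adj (V 0) (V 0 x) + adj (V (Suc 0)) (V (Suc 0) x) = idop (idx p) x" for x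
  proof -
    have "adj (V 0) (V 0 x) + adj (V (Suc 0)) (V (Suc 0) x)
        = adj U (emb i (component i (U x)) + P (U x))"
      unfolding adj_V1 adj_V0 unfolding V0 V1 UU PP clinear_op_add[OF adj_clinear[OF Uc]] ..
    then show ?thesis
      by (simp add: P_def isometry_op_adj[OF unitary_op_isometry[OF U]])
  qed
  ultimately show "convex_coeffs 2 p (\<lambda>j. if j = 0 then m i else p) V"
    unfolding convex_coeffs_def by (auto simp: numeral_2_eq_2 less_Suc_eq)
  show "Y = convex_comb g 2 V (\<lambda>j. if j = 0 then X i else Y)"
  proof (intro nth_equalityI ext)
    fix l x assume "l < length Y"
    then have l: "l < g" by (simp add: Y_def)
    let ?D = "dsum g I X ! l"
    note comp_D = component_dsum[OF X C l]
    have D_idop: "idop ?S (?D v) = ?D v" for v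
      by (rule bop_idop_left[OF sa_tuples_bop[OF dsum_sa_tuples[OF X C] l]])
    have Yl: "(Y ! l) z = adj U (?D (U z))" for z
      unfolding Y_def using l by (simp add: compress_nth del: dsum_nth)
    \<comment> \<open>A direct sum is block diagonal, so it splits into its \<open>i\<close>-th
      block and its compression by \<open>P\<close>.\<close>
    have dec: "emb i ((X i ! l) (component i v)) + P (?D (P v)) = ?D v" for v
      by (rule component_eqI)
        (simp add: clinear_op_add[OF component_clinear] comp_P comp_D component_emb i del: dsum_nth)
    have "(convex_comb g 2 V (\<lambda>j. if j = 0 then X i else Y) ! l) x
        = adj (V 0) ((X i ! l) (V 0 x)) + adj (V (Suc 0)) ((Y ! l) (V (Suc 0) x))"
      using l by (simp add: numeral_2_eq_2)
    also have "\<dots> = adj U (emb i ((X i ! l) (component i (U x))) + P (?D (P (U x))))"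
      unfolding adj_V1 adj_V0 unfolding V0 V1 Yl unitary_op_right[OF U] P_idop D_idop
        clinear_op_add[OF adj_clinear[OF Uc]] ..
    also have "\<dots> = (Y ! l) x"
      unfolding dec Yl ..
    finally show "(Y ! l) x = (convex_comb g 2 V (\<lambda>j. if j = 0 then X i else Y) ! l) x" ..
  qed (simp add: Y_def)
qed

lemma operator_convex_no_summand:
  assumes J: "operator_convex g J" and Z: "Z \<in> free_extreme g J n"
  shows "operator_convex g (\<lambda>m. {Y \<in> J m. \<not> has_summand g n Z m Y})"
    (is "operator_convex g ?J'")
proof (rule operator_convexI)
  note Jg = operator_convex_graded_set[OF J]
  have "Z \<in> J n" using Z by (simp add: free_extreme_def)
  then have "n \<noteq> 0" by (rule graded_set_level[OF Jg])
  \<comment> \<open>Level 0 is excluded, so an isometry leaving level \<open>n\<close> cannot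
    vanish.\<close>
  have nontrivial: "\<exists>x. W x \<noteq> 0" if W: "isometry_op (idx n) T W" for T and W :: "nat ell2 \<Rightarrow> 'b ell2"
  proof (rule ccontr)
    assume "\<nexists>x. W x \<noteq> 0"
    then have "idop (idx n) x = 0" for x
      using isometry_op_adj[OF W, of x] clinear_op_zero[OF adj_clinear[OF bop_clinear[OF isometry_op_bop[OF W]]]]
      by simp
    then have "idx n = {}" by (intro idop_eq_zeroD) auto
    with \<open>n \<noteq> 0\<close> show False by (simp add: idx_eq_empty)
  qed
  show "graded_set g ?J'"
    using Jg by (auto simp: graded_set_def)
  show "compress U X \<in> ?J' p" if X: "X \<in> ?J' p" and U: "unitary_op (idx p) (idx p) U" for p X U
  proof -
    have XJ: "X \<in> J p" using X by simp
    note Xsa = graded_set_sa_tuples[OF Jg XJ]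
    have "has_summand g n Z p X" if summand: "has_summand g n Z p (compress U X)"
    proof -
      obtain W where W: "isometry_op (idx n) (idx p) W"
        and XW: "\<And>l x. l < g \<Longrightarrow> (compress U X ! l) (W x) = W ((Z ! l) x)"
        using summand unfolding has_summand_def by blast
      show ?thesis
      proof (rule has_summandI[OF isometry_op_compose[OF W unitary_op_isometry[OF U]]])
        fix l x assume l: "l < g"
        have "(X ! l) (U (W x)) = U (adj U ((X ! l) (U (W x))))"
          by (simp add: unitary_op_right[OF U] bop_idop_left[OF sa_tuples_bop[OF Xsa l]])
        also have "\<dots> = U (W ((Z ! l) x))"
          using XW[OF l, of x] l sa_tuples_length[OF Xsa] by (simp add: compress_nth)
        finally show "(X ! l) (U (W x)) = U (W ((Z ! l) x))" .
      qed
    qed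
    with X operator_convex_unitary[OF J XJ U] show ?thesis by blast
  qed
  show "convex_comb g k V X \<in> ?J' p"
    if p: "p \<noteq> 0" and X: "\<forall>i<k. X i \<in> ?J' (m i)" and V: "convex_coeffs k p m V" for p k m V X
  proof -
    have XJ: "\<forall>i<k. X i \<in> J (m i)" using X by blast
    have False if summand: "has_summand g n Z p (convex_comb g k V X)"
    proof -
      obtain W where W: "isometry_op (idx n) (idx p) W"
        and XW: "\<And>l x. l < g \<Longrightarrow> (convex_comb g k V X ! l) (W x) = W ((Z ! l) x)"
        using summand unfolding has_summand_def by blast
      obtain x where x: "W x \<noteq> 0" using nontrivial[OF W] by blast
      \<comment> \<open>Were all these vectors zero, the normalisation of the coefficients would
        force \<open>W x = 0\<close>.\<close>
      have "\<exists>i<k. V i (W x) \<noteq> 0"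
      proof (rule ccontr)
        assume "\<not> ?thesis"
        then have "adj (V i) (V i (W x)) = 0" if "i < k" for i
          using that clinear_op_zero[OF adj_clinear[OF bop_clinear[OF convex_coeffs_bop[OF V that]]]]
          by simp
        then have "idop (idx p) (W x) = 0"
          by (simp add: convex_coeffs_sum[OF V, symmetric])
        with x show False by (simp add: bop_idop_left[OF isometry_op_bop[OF W]])
      qed
      then obtain i where i: "i < k" "V i (W x) \<noteq> 0" by blast
      from convex_comb_has_summand[OF Z Jg XJ V W XW i] X i show False by blast
    qed
    with operator_convex_comb[OF J p XJ V] show ?thesis by blast
  qed
  show "compress U (dsum g I X) \<in> ?J' p"
    if I: "I \<noteq> {}" and X: "\<forall>i\<in>I. X i \<in> ?J' (m i)"
      and C: "\<forall>i\<in>I. \<forall>A\<in>set (X i). onorm A \<le> C" and U: "unitary_op (idx p) (sum_idx I m) U"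
    for I m X p U C
  proof -
    define Y where "Y = compress U (dsum g I X)"
    have XJ: "\<forall>i\<in>I. X i \<in> J (m i)" using X by blast
    then have Xsa: "\<forall>i\<in>I. X i \<in> sa_tuples g (idx (m i))"
      using graded_set_sa_tuples[OF Jg] by blast
    have YJ: "Y \<in> J p"
      unfolding Y_def by (rule operator_convex_dsum[OF J I XJ C U])
    have False if summand: "has_summand g n Z p Y"
    proof -
      obtain W where W: "isometry_op (idx n) (idx p) W"
        and YW: "\<And>l x. l < g \<Longrightarrow> (Y ! l) (W x) = W ((Z ! l) x)"
        using summand unfolding has_summand_def by blast
      note UW = isometry_op_compose[OF W unitary_op_isometry[OF U]]
      obtain x where x: "U (W x) \<noteq> 0" using nontrivial[OF UW] by blast
      then obtain i where i: "component i (U (W x)) \<noteq> 0"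
        using component_eqI[of "U (W x)" 0] clinear_op_zero[OF component_clinear] by metis
      then have iI: "i \<in> I"
        using component_idop[of i I m "U (W x)"] bop_idop_left[OF isometry_op_bop[OF UW], of x]
        by (auto split: if_splits)
      note comb = dsum_eq_convex_comb[OF iI Xsa C U, folded Y_def]
      let ?V = "\<lambda>j x. if j = (0::nat) then component i (U x)
        else adj U (U x - emb i (component i (U x)))"
      \<comment> \<open>Using \<open>Y\<close> as a point is not circular: the points only have to
        lie in \<open>J\<close>, and the conclusion is drawn for index 0, that is for
        \<open>X i\<close>, whose coefficient does not vanish at \<open>W x\<close>.\<close>
      let ?X = "\<lambda>j. if j = (0::nat) then X i else Y"
      have XJ': "\<forall>j<2. ?X j \<in> J (if j = 0 then m i else p)"
        using XJ YJ iI by auto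
      have "(convex_comb g 2 ?V ?X ! l) (W x) = W ((Z ! l) x)" if "l < g" for l x
        unfolding comb(2)[symmetric] by (rule YW[OF that])
      from convex_comb_has_summand[OF Z Jg XJ' comb(1) W this, of 0 x] i
      have "has_summand g n Z (m i) (X i)" by simp
      with X iI show False by simp
    qed
    with YJ show ?thesis unfolding Y_def by blast
  qed
qed

section \<open>Gamma-convexity\<close>

context
  fixes g :: nat and \<Gamma> :: "ncpoly list" and K :: graded
  assumes g: "g \<le> length \<Gamma>"
    and poly: "\<forall>p\<in>set \<Gamma>. p \<in> free_algebra g \<and> nc_star p = p"
    and vars: "\<forall>j<g. \<Gamma> ! j = nc_var j"
    and K: "gamma_convex g \<Gamma> K"
begin

lemma gamma_convex_graded_set: "graded_set g K"
  using K by (simp add: gamma_convex_def free_set_def)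

text \<open>A reducing subspace of \<Gamma>(A) reduces A, since A forms its first \<open>g\<close>
  entries. Hence \<open>E\<close> gives a \<Gamma>-pair: \<Gamma>-convexity places the compression
  of A in \<open>K\<close>, and the pair equation shows that \<Gamma> maps it to
  \<open>Y\<close>.\<close>

lemma gamma_summand:
  assumes A: "A \<in> K m" and E: "isometry_op (idx p) (idx m) E" and p: "p \<noteq> 0"
    and Y: "Y \<in> sa_tuples (length \<Gamma>) (idx p)"
    and AE: "\<And>l x. l < length \<Gamma> \<Longrightarrow> (eval_tuple (idx m) \<Gamma> A ! l) (E x) = E ((Y ! l) x)"
  shows "take g Y \<in> K p" "eval_tuple (idx p) \<Gamma> (take g Y) = Y"
proof -
  note Asa = graded_set_sa_tuples[OF gamma_convex_graded_set A]
  have tY: "take g Y \<in> sa_tuples g (idx p)"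
    using Y g by (simp add: sa_tuples_iff)
  have "(A ! l) (E x) = E ((take g Y ! l) x)" if "l < g" for l x
    using AE[of l x] that g vars by (simp add: eval_poly_nc_var[OF Asa])
  note * = E tY _ this
  have "gamma_pair g \<Gamma> (idx p) (idx m) A E"
    using poly by (intro gamma_pair_intertwine[OF *] Asa) auto
  moreover have eq: "compress E A = take g Y"
    by (rule compress_intertwine[OF * ]) (rule sa_tuples_length[OF Asa])
  ultimately show "take g Y \<in> K p"
    using K A p unfolding gamma_convex_def by metis
  have "compress E (eval_tuple (idx m) \<Gamma> A) = Y"
    by (rule compress_intertwine[OF E Y _ AE]) simp
  with \<open>gamma_pair g \<Gamma> (idx p) (idx m) A E\<close> eq
  show "eval_tuple (idx p) \<Gamma> (take g Y) = Y"
    unfolding gamma_pair_def by metis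
qed

lemma operator_convex_opco_gamma_image:
  "operator_convex (length \<Gamma>) (opco (length \<Gamma>) (gamma_image \<Gamma> K))"
proof (rule operator_convex_opco)
  show "gamma_image \<Gamma> K p \<subseteq> all_tuples (length \<Gamma>) p" for p
    using graded_set_sa_tuples[OF gamma_convex_graded_set] graded_set_level[OF gamma_convex_graded_set]
    by (auto simp: gamma_image_def all_tuples_iff intro!: eval_tuple_sa_tuples[OF _ poly])
qed

lemma free_extreme_in_gamma_image:
  assumes Z: "Z \<in> free_extreme (length \<Gamma>) (opco (length \<Gamma>) (gamma_image \<Gamma> K)) n"
  shows "Z \<in> gamma_image \<Gamma> K n"
proof (rule ccontr)
  assume not_in: "Z \<notin> gamma_image \<Gamma> K n"
  let ?r = "length \<Gamma>" and ?J = "opco (length \<Gamma>) (gamma_image \<Gamma> K)"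
  let ?J' = "\<lambda>m. {Y \<in> ?J m. \<not> has_summand ?r n Z m Y}"
  note J = operator_convex_opco_gamma_image
  note Jg = operator_convex_graded_set[OF J]
  have ZJ: "Z \<in> ?J n" using Z by (simp add: free_extreme_def)
  note Zsa = graded_set_sa_tuples[OF Jg ZJ] and n = graded_set_level[OF Jg ZJ]
  have "gamma_image \<Gamma> K p \<subseteq> ?J' p" for p
  proof
    fix Y assume Y: "Y \<in> gamma_image \<Gamma> K p"
    then obtain A where A: "A \<in> K p" "Y = eval_tuple (idx p) \<Gamma> A"
      by (auto simp: gamma_image_def)
    have False if summand: "has_summand ?r n Z p Y"
    proof -
      obtain W where W: "isometry_op (idx n) (idx p) W"
        and YW: "\<And>l x. l < ?r \<Longrightarrow> (Y ! l) (W x) = W ((Z ! l) x)"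
        using summand unfolding has_summand_def by blast
      \<comment> \<open>A summand \<open>Z\<close> of \<Gamma>(A) would be \<Gamma> of
        \<open>take g Z\<close>, with \<open>take g Z\<close> in \<open>K\<close>.\<close>
      from gamma_summand[OF A(1) W n Zsa YW[unfolded A(2)]] not_in show False
        by (metis gamma_image_def imageI)
    qed
    then show "Y \<in> ?J' p" using Y opco_superset by blast
  qed
  then have "?J n \<subseteq> ?J' n"
    by (rule opco_subset[OF operator_convex_no_summand[OF J Z]])
  with ZJ has_summand_self[OF Zsa] show False by blast
qed

text \<open>Both blocks of \<Gamma>(A) are restrictions to reducing subspaces, so their truncations
  lie in \<open>K\<close>. The block formula is entrywise, so its first \<open>g\<close> entries
  split A along the same \<open>E\<close> and \<open>F\<close>.\<close>

lemma gamma_splits: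
  assumes J: "graded_set (length \<Gamma>) J" and A: "A \<in> K m" and X: "X \<in> sa_tuples g (idx n)"
    and sp: "splits J V m (eval_tuple (idx m) \<Gamma> A) n (eval_tuple (idx n) \<Gamma> X)"
  shows "splits K V m A n X"
  using sp J
proof (rule splitsE)
  fix p Y E
  assume Y: "Y \<in> J p" and UE: "unitarily_equiv p Y n (eval_tuple (idx n) \<Gamma> X)"
    and E: "isometry_op (idx p) (idx m) E" "range E = range V"
    and AE: "\<forall>l<length \<Gamma>. \<forall>x. (eval_tuple (idx m) \<Gamma> A ! l) (E x) = E ((Y ! l) x)"
    and onto: "range V = hil (idx m) \<Longrightarrow> eval_tuple (idx m) \<Gamma> A = map (\<lambda>B. E \<circ> B \<circ> adj E) Y"
    and not_onto: "range V \<noteq> hil (idx m) \<Longrightarrow> \<exists>q Z F. Z \<in> J q \<and> isometry_op (idx q) (idx m) F \<and>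
      range F = {y \<in> hil (idx m). \<forall>x. cinner (V x) y = 0} \<and>
      eval_tuple (idx m) \<Gamma> A = map2 (\<lambda>B C x. E (B (adj E x)) + F (C (adj F x))) Y Z \<and>
      (\<forall>l<length \<Gamma>. \<forall>x. (eval_tuple (idx m) \<Gamma> A ! l) (F x) = F ((Z ! l) x))"
  note Asa = graded_set_sa_tuples[OF gamma_convex_graded_set A]
  note summand = gamma_summand(1)[OF A _ graded_set_level[OF J] graded_set_sa_tuples[OF J]]
  note takeA = take_eval_tuple[OF Asa g vars]
  have tY: "take g Y \<in> K p"
    by (rule summand[OF E(1) Y Y AE[rule_format]])
  from UE obtain U where U: "unitary_op (idx n) (idx p) U"
    "compress U Y = eval_tuple (idx n) \<Gamma> X"
    unfolding unitarily_equiv_def by blast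
  have "compress U (take g Y) = take g (compress U Y)"
    by (simp add: compress_def take_map)
  then have tUE: "unitarily_equiv p (take g Y) n X"
    using U take_eval_tuple[OF X g vars] unfolding unitarily_equiv_def by auto
  have split: "if range V = hil (idx m)
      then A = map (\<lambda>B. E \<circ> B \<circ> adj E) (take g Y)
      else \<exists>q Z F. Z \<in> K q \<and> isometry_op (idx q) (idx m) F \<and>
        range F = {y \<in> hil (idx m). \<forall>x. cinner (V x) y = 0} \<and>
        A = map2 (\<lambda>B C x. E (B (adj E x)) + F (C (adj F x))) (take g Y) Z"
  proof (cases "range V = hil (idx m)")
    case True
    then show ?thesis
      using onto takeA by (simp add: take_map)
  next
    case False
    then obtain q Z F where Z: "Z \<in> J q" and F: "isometry_op (idx q) (idx m) F"
      "range F = {y \<in> hil (idx m). \<forall>x. cinner (V x) y = 0}"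
      and eq: "eval_tuple (idx m) \<Gamma> A = map2 (\<lambda>B C x. E (B (adj E x)) + F (C (adj F x))) Y Z"
      and AF: "\<And>l x. l < length \<Gamma> \<Longrightarrow> (eval_tuple (idx m) \<Gamma> A ! l) (F x) = F ((Z ! l) x)"
      using not_onto by blast
    have "take g Z \<in> K q"
      by (rule summand[OF F(1) Z Z AF])
    moreover have "A = map2 (\<lambda>B C x. E (B (adj E x)) + F (C (adj F x))) (take g Y) (take g Z)"
      using takeA unfolding eq by (simp add: take_map take_zip)
    ultimately show ?thesis
      unfolding if_not_P[OF False] using F by blast
  qed
  show "splits K V m A n X"
    unfolding splits_def
    by (rule exI[of _ p], rule exI[of _ "take g Y"], rule exI[of _ E]) (intro conjI tY tUE E split)
qed

text \<open>Compressing the direct sum by the column gives the combination of the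
  \<open>A i\<close>; compressing \<Gamma> of the direct sum gives the combination of the \<Gamma>(A
  i), since polynomials act blockwise. The \<Gamma>-pair condition identifies \<Gamma> of the first
  with the second.\<close>

lemma eval_tuple_convex_comb:
  assumes A: "\<forall>i<k. A i \<in> K (m i)" and V: "convex_coeffs k n m V"
    and pair: "gamma_pair g \<Gamma> (idx n) (sum_idx {..<k} m) (dsum g {..<k} A) (col k V)"
  shows "eval_tuple (idx n) \<Gamma> (convex_comb g k V A)
    = convex_comb (length \<Gamma>) k V (\<lambda>i. eval_tuple (idx (m i)) \<Gamma> (A i))"
proof -
  let ?I = "{..<k}"
  let ?D = "dsum g ?I A"
  have Asa: "\<forall>i\<in>?I. A i \<in> sa_tuples g (idx (m i))"
    using A graded_set_sa_tuples[OF gamma_convex_graded_set] by auto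
  \<comment> \<open>The family is finite, so a maximum is a common norm bound; if there are no
    operators at all, the claim is vacuous.\<close>
  have C: "\<forall>i\<in>?I. \<forall>B\<in>set (A i). onorm B \<le> Max (\<Union>i\<in>?I. onorm ` set (A i))"
    by (auto intro!: Max_ge)
  have Vc: "clinear_op (V i)" if "i < k" for i
    by (rule bop_clinear[OF convex_coeffs_bop[OF V that]])
  \<comment> \<open>Stated for any blockwise \<open>T\<close>, this covers both the direct sum and
    its polynomial evaluations.\<close>
  have comp: "adj (col k V) (T (col k V x)) = (\<Sum>i<k. adj (V i) (B i (V i x)))"
    if "\<And>i y. i < k \<Longrightarrow> component i (T y) = B i (component i y)" for T B x
    by (simp add: adj_col[OF Vc] that component_col)
  have "compress (col k V) ?D = convex_comb g k V A"
    by (intro nth_equalityI ext)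
      (auto simp: compress_nth component_dsum[OF Asa C] simp del: dsum_nth intro!: comp)
  moreover have "compress (col k V) (eval_tuple (sum_idx ?I m) \<Gamma> ?D)
      = convex_comb (length \<Gamma>) k V (\<lambda>i. eval_tuple (idx (m i)) \<Gamma> (A i))"
    using poly
    by (intro nth_equalityI ext)
      (auto simp: compress_nth component_eval_poly_dsum[OF Asa C] intro!: comp)
  ultimately show ?thesis
    using pair unfolding gamma_pair_def by simp
qed

text \<open>Membership of \<open>X\<close> in \<open>K\<close> is derived: \<Gamma>(X) lies in the
  image of \<open>K\<close>, and \<Gamma> is injective. Extremality of \<Gamma>(X) is then applied
  to the image under \<Gamma> of a combination for \<open>X\<close>.\<close>

lemma gamma_extreme_of_free_extreme:
  assumes X: "X \<in> sa_tuples g (idx n)"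
    and ext: "eval_tuple (idx n) \<Gamma> X
      \<in> free_extreme (length \<Gamma>) (opco (length \<Gamma>) (gamma_image \<Gamma> K)) n"
  shows "X \<in> gamma_extreme g \<Gamma> K n"
proof -
  let ?J = "opco (length \<Gamma>) (gamma_image \<Gamma> K)"
  note Kg = gamma_convex_graded_set
  from free_extreme_in_gamma_image[OF ext]
  obtain X' where X': "X' \<in> K n" "eval_tuple (idx n) \<Gamma> X = eval_tuple (idx n) \<Gamma> X'"
    by (auto simp: gamma_image_def)
  then have "X = X'"
    using take_eval_tuple[OF X g vars] take_eval_tuple[OF graded_set_sa_tuples[OF Kg X'(1)] g vars]
    by metis
  with X' have XK: "X \<in> K n" by simp
  have "\<exists>c W. isometry_op (idx n) (idx (m i)) W \<and> V i = (\<lambda>x. c *\<^sub>C W x) \<and>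
      gamma_pair g \<Gamma> (idx n) (idx (m i)) (A i) W \<and> splits K (V i) (m i) (A i) n X"
    if A: "\<forall>i<k. A i \<in> K (m i) \<and> V i \<noteq> (\<lambda>_. 0)" and V: "convex_coeffs k n m V"
      and comb: "X = convex_comb g k V A"
      and pair: "gamma_pair g \<Gamma> (idx n) (sum_idx {..<k} m) (dsum g {..<k} A) (col k V)"
      and i: "i < k" for k m V A i
  proof -
    let ?A = "\<lambda>i. eval_tuple (idx (m i)) \<Gamma> (A i)"
    have "eval_tuple (idx n) \<Gamma> X = convex_comb (length \<Gamma>) k V ?A"
      unfolding comb using A by (intro eval_tuple_convex_comb[OF _ V pair]) blast
    moreover have "\<forall>i<k. ?A i \<in> ?J (m i) \<and> V i \<noteq> (\<lambda>_. 0)"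
      using A by (auto simp: gamma_image_def intro!: subsetD[OF opco_superset])
    ultimately obtain c W where W: "isometry_op (idx n) (idx (m i)) W" "V i = (\<lambda>x. c *\<^sub>C W x)"
      "compress W (?A i) = eval_tuple (idx n) \<Gamma> X"
      "splits ?J (V i) (m i) (?A i) n (eval_tuple (idx n) \<Gamma> X)"
      using free_extremeD[OF ext _ V _ i, of ?A] by blast
    have AiK: "A i \<in> K (m i)" using A i by blast
    note Asa = graded_set_sa_tuples[OF Kg AiK]
    \<comment> \<open>Compression is entrywise and so commutes with truncation. The resulting
      equation for \<open>A i\<close>, together with the one for its image under \<Gamma>, is the
      \<Gamma>-pair condition for \<open>W\<close>.\<close>
    have "compress W (A i) = take g (compress W (?A i))"
      unfolding compress_def take_map take_eval_tuple[OF Asa g vars] ..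
    then have "compress W (A i) = X"
      unfolding W(3) take_eval_tuple[OF X g vars] .
    then have "gamma_pair g \<Gamma> (idx n) (idx (m i)) (A i) W"
      using W(1,3) Asa by (simp add: gamma_pair_def)
    moreover have "splits K (V i) (m i) (A i) n X"
      by (rule gamma_splits[OF operator_convex_graded_set[OF operator_convex_opco_gamma_image]
            AiK X W(4)])
    ultimately show ?thesis
      using W(1,2) by blast
  qed
  with XK show ?thesis
    unfolding gamma_extreme_def by blast
qed

end

theorem proposition3p25:
  fixes g r :: nat and \<Gamma> :: "ncpoly list" and K :: graded
  assumes "1 \<le> g" and "g \<le> r" and "length \<Gamma> = r"
    and "\<forall>p\<in>set \<Gamma>. p \<in> free_algebra g \<and> nc_star p = p"
    and "\<forall>j<g. \<Gamma> ! j = nc_var j"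
    and "gamma_convex g \<Gamma> K"
  shows "(\<forall>n Z. Z \<in> free_extreme r (opco r (gamma_image \<Gamma> K)) n \<longrightarrow>
            (\<exists>X \<in> gamma_extreme g \<Gamma> K n. Z = eval_tuple (idx n) \<Gamma> X)) \<and>
         (\<forall>n. free_extreme r (opco r (gamma_image \<Gamma> K)) n
            \<subseteq> gamma_image \<Gamma> (gamma_extreme g \<Gamma> K) n) \<and>
         (\<forall>n. n \<noteq> 0 \<longrightarrow> (\<forall>X \<in> sa_tuples g (idx n).
            eval_tuple (idx n) \<Gamma> X \<in> free_extreme r (opco r (gamma_image \<Gamma> K)) n \<longrightarrow>
            X \<in> gamma_extreme g \<Gamma> K n))"
proof -
  have g: "g \<le> length \<Gamma>" using assms(2,3) by simp
  note hyps = g assms(4-6)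
  note ext = gamma_extreme_of_free_extreme[OF hyps, unfolded assms(3)]
  have *: "\<exists>X \<in> gamma_extreme g \<Gamma> K n. Z = eval_tuple (idx n) \<Gamma> X"
    if Z: "Z \<in> free_extreme r (opco r (gamma_image \<Gamma> K)) n" for n Z
  proof -
    from free_extreme_in_gamma_image[OF hyps, unfolded assms(3), OF Z]
    obtain X where X: "X \<in> K n" "Z = eval_tuple (idx n) \<Gamma> X"
      by (auto simp: gamma_image_def)
    then have "X \<in> sa_tuples g (idx n)"
      using graded_set_sa_tuples[OF gamma_convex_graded_set[OF hyps]] by blast
    with ext Z X show ?thesis by blast
  qed
  then have "free_extreme r (opco r (gamma_image \<Gamma> K)) n
      \<subseteq> gamma_image \<Gamma> (gamma_extreme g \<Gamma> K) n" for n
    unfolding gamma_image_def by blast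
  with * ext show ?thesis by blast
qed

end
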